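(* Let $k \geq 1$ and $n \geq 4k$ be integers, and let $w = w(x_0,\ldots,x_k)$ be a cyclically reduced word in the free group on $x_0,\ldots,x_k$ which involves both $x_0$ and $x_k$ (and perhaps other generators). Let $$G = G_n(w) = \langle x_0,\ldots,x_{n-1} \mid w(x_0,\ldots,x_k),\, w(x_1,\ldots,x_{k+1}),\ldots, w(x_{n-1},x_0,\ldots,x_{k-1})\rangle$$ (subscripts mod $n$), and let $$H_1 = \langle x_0,\ldots,x_{3k-1} \mid w(x_0,\ldots,x_k),\, w(x_1,\ldots,x_{k+1}),\ldots,w(x_{2k-1},\ldots,x_{3k-1})\rangle .$$ If $$\langle x_0,\ldots,x_{k-1}\rangle \cap \langle x_1,\ldots,x_k\rangle \cap \cdots \cap \langle x_k,\ldots,x_{2k-1}\rangle = \{1\}$$ in the group $H_1$ (that is, $\bigcap_{j=0}^{k} \langle x_j,\ldots,x_{j+k-1}\rangle = \{1\}$ as subgroups of $H_1$), then for each $i$ with $0 \leq i \leq n-1$ the one-relator group $\langle x_i,\ldots,x_{i+k} \mid w\theta^i\rangle$ (subscripts mod $n$) embeds in $G_n(w)$. In particular, $G_n(w)$ is an infinite group.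
   Context: $F_n$ denotes the free group of rank $n$ on $x_0,\ldots,x_{n-1}$, and $\theta\colon F_n\to F_n$ is the automorphism with $x_i\theta = x_{i+1}$ (subscripts mod $n$), so $w\theta^i = w(x_i,x_{i+1},\ldots,x_{i+k})$. For $w\in F_n$, $G_n(w)=F_n/N$ where $N$ is the normal closure of $\{w,w\theta,\ldots,w\theta^{n-1}\}$; this is the cyclically presented group defined by $w$. A word "involves" a generator $x_j$ if $x_j$ or $x_j^{-1}$ occurs in it. *)

theory Defs
  imports "HOL-Algebra.Generated_Groups"
begin

text \<open>The letter \<open>(x, True)\<close> stands for the generator \<open>x\<close>, and \<open>(x, False)\<close> for its inverse.\<close>

type_synonym 'a letter = "'a \<times> bool"
type_synonym 'a word = "'a letter list"

definition letter_inv :: "'a letter \<Rightarrow> 'a letter" where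
  "letter_inv l = (fst l, \<not> snd l)"

fun reduced :: "'a word \<Rightarrow> bool" where
  "reduced [] = True"
| "reduced [l] = True"
| "reduced (l # m # ls) = (m \<noteq> letter_inv l \<and> reduced (m # ls))"

definition cyclically_reduced :: "'a word \<Rightarrow> bool" where
  "cyclically_reduced w \<longleftrightarrow> reduced w \<and> (w \<noteq> [] \<longrightarrow> hd w \<noteq> letter_inv (last w))"

definition involves :: "'a word \<Rightarrow> 'a \<Rightarrow> bool" where
  "involves w x \<longleftrightarrow> (x, True) \<in> set w \<or> (x, False) \<in> set w"

fun cancel_cons :: "'a letter \<Rightarrow> 'a word \<Rightarrow> 'a word" where
  "cancel_cons l [] = [l]"
| "cancel_cons l (m # ls) = (if m = letter_inv l then ls else l # m # ls)"

definition free_reduce :: "'a word \<Rightarrow> 'a word" where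
  "free_reduce w = foldr cancel_cons w []"

definition free_group :: "'a set \<Rightarrow> 'a word monoid" where
  "free_group X =
     \<lparr>carrier = {w. reduced w \<and> fst ` set w \<subseteq> X},
      mult = (\<lambda>v w. free_reduce (v @ w)),
      one = []\<rparr>"

lemma letter_inv_letter_inv [simp]: "letter_inv (letter_inv l) = l"
  by (simp add: letter_inv_def)

lemma fst_letter_inv [simp]: "fst (letter_inv l) = fst l"
  by (simp add: letter_inv_def)

lemma letter_inv_neq [simp]: "letter_inv l \<noteq> l" "l \<noteq> letter_inv l"
  by (cases l; simp add: letter_inv_def)+

lemma letter_inv_inject [simp]: "letter_inv l = letter_inv m \<longleftrightarrow> l = m"
  by (metis letter_inv_letter_inv)

lemma reduced_ConsD: "reduced (l # ls) \<Longrightarrow> reduced ls"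
  by (cases ls) auto

lemma reduced_cancel_cons: "reduced w \<Longrightarrow> reduced (cancel_cons l w)"
  by (cases w) (auto dest: reduced_ConsD)

lemma cancel_cons_letter_inv:
  "reduced w \<Longrightarrow> cancel_cons l (cancel_cons (letter_inv l) w) = w"
proof (cases w)
  case (Cons m ls)
  moreover assume "reduced w"
  ultimately show ?thesis by (cases ls) auto
qed simp

lemma reduced_foldr_cancel_cons: "reduced w \<Longrightarrow> reduced (foldr cancel_cons v w)"
  by (induction v) (auto intro: reduced_cancel_cons)

lemma reduced_free_reduce: "reduced (free_reduce w)"
  by (simp add: free_reduce_def reduced_foldr_cancel_cons)

lemma free_reduce_id: "reduced w \<Longrightarrow> free_reduce w = w"
proof (induction w)
  case (Cons l w)
  then show ?case
    by (cases w) (auto simp: free_reduce_def dest: reduced_ConsD)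
qed (simp add: free_reduce_def)

lemma foldr_cancel_cons_cancel_cons:
  "reduced u \<Longrightarrow> foldr cancel_cons (cancel_cons l v) u = cancel_cons l (foldr cancel_cons v u)"
proof (cases v)
  case (Cons m ls)
  assume "reduced u"
  with Cons show ?thesis
    using cancel_cons_letter_inv[of "foldr cancel_cons ls u" l]
    by (auto simp: reduced_foldr_cancel_cons)
qed simp

lemma foldr_free_reduce:
  "reduced u \<Longrightarrow> foldr cancel_cons (free_reduce v) u = foldr cancel_cons v u"
  by (induction v) (auto simp: free_reduce_def foldr_cancel_cons_cancel_cons)

lemma free_reduce_append_left: "free_reduce (free_reduce v @ w) = free_reduce (v @ w)"
  by (metis foldr_append foldr_free_reduce free_reduce_def reduced_free_reduce)

lemma free_reduce_append_right: "free_reduce (v @ free_reduce w) = free_reduce (v @ w)"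
proof -
  have "foldr cancel_cons (free_reduce w) [] = foldr cancel_cons w []"
    by (rule foldr_free_reduce) simp
  then show ?thesis by (simp add: free_reduce_def)
qed

lemma set_cancel_cons: "set (cancel_cons l w) \<subseteq> insert l (set w)"
  by (cases w) auto

lemma set_free_reduce: "set (free_reduce w) \<subseteq> set w"
proof (induction w)
  case (Cons l w)
  then show ?case
    using set_cancel_cons[of l "free_reduce w"] by (auto simp: free_reduce_def)
qed (simp add: free_reduce_def)

lemma free_reduce_inverse: "free_reduce (rev (map letter_inv w) @ w) = []"
proof (induction w)
  case (Cons l w)
  have "free_reduce (rev (map letter_inv (l # w)) @ l # w)
      = foldr cancel_cons (rev (map letter_inv w)) (cancel_cons (letter_inv l) (cancel_cons l (free_reduce w)))"
    by (simp add: free_reduce_def)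
  also have "cancel_cons (letter_inv l) (cancel_cons l (free_reduce w)) = free_reduce w"
    using cancel_cons_letter_inv[of "free_reduce w" "letter_inv l"]
    by (simp add: reduced_free_reduce)
  also have "foldr cancel_cons (rev (map letter_inv w)) (free_reduce w)
      = free_reduce (rev (map letter_inv w) @ w)"
    by (simp add: free_reduce_def)
  finally show ?case using Cons.IH by simp
qed (simp add: free_reduce_def)

lemma group_free_group: "group (free_group X)"
proof (rule groupI)
  fix v w assume "v \<in> carrier (free_group X)" "w \<in> carrier (free_group X)"
  then show "v \<otimes>\<^bsub>free_group X\<^esub> w \<in> carrier (free_group X)"
    using set_free_reduce[of "v @ w"]
    by (fastforce simp: free_group_def reduced_free_reduce)
next
  fix w assume w: "w \<in> carrier (free_group X)"
  let ?v = "free_reduce (rev (map letter_inv w))"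
  have "?v \<in> carrier (free_group X)"
    using w set_free_reduce[of "rev (map letter_inv w)"]
    by (fastforce simp: free_group_def reduced_free_reduce)
  moreover have "?v \<otimes>\<^bsub>free_group X\<^esub> w = \<one>\<^bsub>free_group X\<^esub>"
    by (simp add: free_group_def free_reduce_append_left free_reduce_inverse)
  ultimately show "\<exists>v\<in>carrier (free_group X). v \<otimes>\<^bsub>free_group X\<^esub> w = \<one>\<^bsub>free_group X\<^esub>"
    by blast
qed (simp_all add: free_group_def free_reduce_append_left free_reduce_append_right free_reduce_id)

definition normal_closure :: "('a, 'b) monoid_scheme \<Rightarrow> 'a set \<Rightarrow> 'a set" where
  "normal_closure G R = \<Inter> {N. N \<lhd> G \<and> R \<subseteq> N}"

definition presented_group :: "'a set \<Rightarrow> 'a word set \<Rightarrow> 'a word set monoid" where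
  "presented_group X R = free_group X Mod normal_closure (free_group X) R"

definition presented_gen :: "'a set \<Rightarrow> 'a word set \<Rightarrow> 'a \<Rightarrow> 'a word set" where
  "presented_gen X R x = normal_closure (free_group X) R #>\<^bsub>free_group X\<^esub> [(x, True)]"

lemma normal_normal_closure:
  assumes "group G" "R \<subseteq> carrier G"
  shows "normal_closure G R \<lhd> G"
proof -
  interpret group G by fact
  have "carrier G \<lhd> G"
    by (rule normal_invI) (auto intro: subgroup_self)
  then have ne: "{N. N \<lhd> G \<and> R \<subseteq> N} \<noteq> {}"
    using assms(2) by blast
  show ?thesis
    unfolding normal_closure_def
  proof (rule normal_invI)
    show "subgroup (\<Inter> {N. N \<lhd> G \<and> R \<subseteq> N}) G"
      using ne by (intro subgroups_Inter) (auto dest: normal_imp_subgroup)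
  next
    fix x h assume "x \<in> carrier G" "h \<in> \<Inter> {N. N \<lhd> G \<and> R \<subseteq> N}"
    then show "x \<otimes>\<^bsub>G\<^esub> h \<otimes>\<^bsub>G\<^esub> inv\<^bsub>G\<^esub> x \<in> \<Inter> {N. N \<lhd> G \<and> R \<subseteq> N}"
      by (auto intro: normal.inv_op_closed2)
  qed
qed

lemma group_presented_group:
  "R \<subseteq> carrier (free_group X) \<Longrightarrow> group (presented_group X R)"
  unfolding presented_group_def
  by (intro normal.factorgroup_is_group normal_normal_closure group_free_group)

definition relabel :: "('a \<Rightarrow> 'b) \<Rightarrow> 'a word \<Rightarrow> 'b word" where
  "relabel f w = map (\<lambda>(x, b). (f x, b)) w"

text \<open>
  For \<open>n > 0\<close>, the automorphism of the free group on \<open>x\<^sub>0, \<dots>, x\<^sub>n\<^sub>-\<^sub>1\<close> sending \<open>x\<^sub>i\<close> to \<open>x\<^sub>i\<^sub>+\<^sub>1\<close>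
  (subscripts mod \<open>n\<close>). It permutes the generators, so it acts on reduced words letter by letter.
\<close>

definition theta :: "nat \<Rightarrow> nat word \<Rightarrow> nat word" where
  "theta n = relabel (\<lambda>i. (i + 1) mod n)"

definition cyclic_relators :: "nat \<Rightarrow> nat word \<Rightarrow> nat word set" where
  "cyclic_relators n w = {(theta n ^^ i) w | i. i < n}"

definition cyclically_presented_group :: "nat \<Rightarrow> nat word \<Rightarrow> nat word set monoid" where
  "cyclically_presented_group n w = presented_group {0..<n} (cyclic_relators n w)"

lemma relabel_cancel_cons:
  assumes "inj_on f X" "fst l \<in> X" "fst ` set w \<subseteq> X"
  shows "relabel f (cancel_cons l w) = cancel_cons (f (fst l), snd l) (relabel f w)"
proof (cases w)
  case (Cons m ls)
  then have "m = letter_inv l \<longleftrightarrow> (f (fst m), snd m) = letter_inv (f (fst l), snd l)"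
    using assms by (cases l; cases m) (auto simp: letter_inv_def inj_on_def)
  then show ?thesis
    using Cons by (simp add: relabel_def case_prod_beta)
qed (simp add: relabel_def case_prod_beta)

lemma relabel_free_reduce:
  assumes "inj_on f X"
  shows "fst ` set w \<subseteq> X \<Longrightarrow> relabel f (free_reduce w) = free_reduce (relabel f w)"
proof (induction w)
  case (Cons l w)
  have "fst ` set (free_reduce w) \<subseteq> X"
    using set_free_reduce[of w] Cons.prems by auto
  then have "relabel f (cancel_cons l (free_reduce w))
      = cancel_cons (f (fst l), snd l) (relabel f (free_reduce w))"
    using Cons.prems by (intro relabel_cancel_cons[OF assms]) auto
  then show ?case
    using Cons by (simp add: free_reduce_def relabel_def case_prod_beta)
qed (simp add: free_reduce_def relabel_def)

lemma relabel_closed: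
  assumes "bij_betw f X Y" "w \<in> carrier (free_group X)"
  shows "relabel f w \<in> carrier (free_group Y)"
proof -
  have "relabel f w = free_reduce (relabel f w)"
    using assms relabel_free_reduce[of f X w]
    by (simp add: free_group_def free_reduce_id bij_betw_def)
  then have "reduced (relabel f w)" by (metis reduced_free_reduce)
  moreover have "fst ` set (relabel f w) = f ` fst ` set w"
    by (force simp: relabel_def)
  ultimately show ?thesis
    using assms by (auto simp: free_group_def bij_betw_def)
qed

lemma relabel_relabel_id:
  assumes "\<And>x. x \<in> X \<Longrightarrow> g (f x) = x" "w \<in> carrier (free_group X)"
  shows "relabel g (relabel f w) = w"
  using assms by (force simp: relabel_def free_group_def case_prod_beta intro: map_idI)

lemma relabel_iso:
  assumes f: "bij_betw f X Y"
  shows "relabel f \<in> iso (free_group X) (free_group Y)"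
proof -
  have inj: "inj_on f X" using f by (rule bij_betw_imp_inj_on)
  have "relabel f \<in> hom (free_group X) (free_group Y)"
  proof (rule homI)
    fix v w assume "v \<in> carrier (free_group X)" "w \<in> carrier (free_group X)"
    then show "relabel f (v \<otimes>\<^bsub>free_group X\<^esub> w) = relabel f v \<otimes>\<^bsub>free_group Y\<^esub> relabel f w"
      using relabel_free_reduce[OF inj, of "v @ w"]
      by (auto simp: free_group_def relabel_def)
  qed (rule relabel_closed[OF f])
  moreover have "bij_betw (relabel f) (carrier (free_group X)) (carrier (free_group Y))"
  proof (rule bij_betw_byWitness[where f' = "relabel (inv_into X f)"])
    show "\<forall>w\<in>carrier (free_group X). relabel (inv_into X f) (relabel f w) = w"
      using inj by (auto intro!: relabel_relabel_id[where X = X])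
    show "\<forall>w\<in>carrier (free_group Y). relabel f (relabel (inv_into X f) w) = w"
      using f by (auto intro!: relabel_relabel_id[where X = Y] simp: bij_betw_inv_into_right)
  qed (use f in \<open>auto intro: relabel_closed bij_betw_inv_into\<close>)
  ultimately show ?thesis by (simp add: iso_def)
qed

lemma theta_automorphism:
  assumes "n > 0"
  shows "theta n \<in> iso (free_group {0..<n}) (free_group {0..<n})"
proof -
  have "(\<lambda>i. (i + 1) mod n) ` {0..<n} \<subseteq> {0..<n}"
    using assms by auto
  moreover have "inj_on (\<lambda>i. (i + 1) mod n) {0..<n}"
    by (auto simp: inj_on_def mod_Suc split: if_splits)
  ultimately have "bij_betw (\<lambda>i. (i + 1) mod n) {0..<n} {0..<n}"
    by (simp add: bij_betw_def endo_inj_surj)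
  then show ?thesis
    unfolding theta_def by (rule relabel_iso)
qed

end

(*
  Any k consecutive generators freely generate a free subgroup of each one-relator group
  B_i = <x_i, ..., x_{i+k} | w theta^i> by Magnus' Freiheitssatz, so the relators of an arc
  p, ..., q of the cycle present an iterated amalgam B_p * ... * B_q over the free groups
  F_i = <x_i, ..., x_{i+k-1}>. An element common to two of the F_i lies in all those in between;
  hence the hypothesis says that F_p and F_{p+k} meet trivially. Splitting the amalgam at F_{p+k}
  and using the normal form theorem, F_p and F_{q+1} generate their free product as soon as the
  arc has at least 2k relators. Since n >= 4k, the cycle is the union of two such arcs, so G is the
  amalgam of two arc groups over the free group on the two blocks of k generators that they share.

  The Freiheitssatz is Magnus' induction on the length of w. A weight phi with phi(w) = 0 and
  phi(a) nonzero maps the group to Z; its kernel is presented by the shifts of a shorter relator,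
  which again form a chain of amalgams over free groups.
*)

theory Submission
  imports Defs "HOL-Library.Countable"
begin

section \<open>Words and congruences\<close>

text \<open>The constants come from the splitting. The k relators p, ..., p+k-1 are enough to bring
  together the blocks that start at p, ..., p+k. An arc split at the block starting at p+k must have
  that many on each side, so an arc has at least 2k relators and a cycle made of two arcs has at
  least 4k.

  Pieces over different alphabets are glued again and again. The argument therefore runs on
  unreduced words modulo a congruence, where passing to a subgroup is only a restriction of the
  letters; quotient groups enter through a dictionary. The normal form theorem comes from an action
  of words on normal forms, so that no product of normal forms has to be shown associative.

  In the Freiheitssatz phi(a) may be any nonzero integer, which replaces Magnus' adjunction of a
  root when no exponent sum vanishes. Rewriting is used in one direction only: it carries relations
  to relations and reduced words to reduced words. That direction suffices to show that a subgroup
  is free.\<close>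

definition words :: "'a set \<Rightarrow> 'a word set" where
  "words X = {u. fst ` set u \<subseteq> X}"

lemma words_Nil [simp]: "[] \<in> words X"
  by (simp add: words_def)

lemma words_Cons [simp]: "l # u \<in> words X \<longleftrightarrow> fst l \<in> X \<and> u \<in> words X"
  by (auto simp: words_def)

lemma words_append [simp]: "u @ v \<in> words X \<longleftrightarrow> u \<in> words X \<and> v \<in> words X"
  by (auto simp: words_def)

lemma words_mono: "u \<in> words X \<Longrightarrow> X \<subseteq> Y \<Longrightarrow> u \<in> words Y"
  by (auto simp: words_def)

lemma words_Int: "u \<in> words (X \<inter> Y) \<longleftrightarrow> u \<in> words X \<and> u \<in> words Y"
  by (auto simp: words_def)

definition winv :: "'a word \<Rightarrow> 'a word" where
  "winv u = rev (map letter_inv u)"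

lemma winv_Nil [simp]: "winv [] = []"
  by (simp add: winv_def)

lemma winv_winv [simp]: "winv (winv u) = u"
  by (simp add: winv_def rev_map comp_def)

lemma words_winv [simp]: "winv u \<in> words X \<longleftrightarrow> u \<in> words X"
  by (simp add: words_def winv_def image_image)

lemma reduced_Cons: "reduced (l # u) \<longleftrightarrow> (u \<noteq> [] \<longrightarrow> hd u \<noteq> letter_inv l) \<and> reduced u"
  by (cases u) auto

lemma reduced_append:
  "reduced (u @ v) \<longleftrightarrow> reduced u \<and> reduced v \<and> (u \<noteq> [] \<longrightarrow> v \<noteq> [] \<longrightarrow> hd v \<noteq> letter_inv (last u))"
  by (induction u) (auto simp: reduced_Cons)

text \<open>Equality in the group presented by \<open>R\<close>, with all letters of the type as
  generators. No alphabet is fixed, so words of different pieces can be compared directly; letters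
  that do not occur in \<open>R\<close> are free, and \<open>cong {}\<close> is equality in the free
  group.\<close>

inductive cong :: "'a word set \<Rightarrow> 'a word \<Rightarrow> 'a word \<Rightarrow> bool" for R where
  cong_refl [simp, intro]: "cong R u u"
| cong_sym: "cong R u v \<Longrightarrow> cong R v u"
| cong_trans [trans]: "cong R u v \<Longrightarrow> cong R v w \<Longrightarrow> cong R u w"
| cong_context: "cong R u v \<Longrightarrow> cong R (x @ u @ y) (x @ v @ y)"
| cong_cancel: "cong R [l, letter_inv l] []"
| cong_relator: "r \<in> R \<Longrightarrow> cong R r []"

lemma cong_append:
  assumes "cong R u u'" "cong R v v'"
  shows "cong R (u @ v) (u' @ v')"
  using cong_context[OF assms(1), of "[]" v] cong_context[OF assms(2), of u' "[]"]
  by (auto intro: cong_trans)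

lemma cong_winv_right: "cong R (u @ winv u) []"
proof (induction u)
  case (Cons l u)
  have "cong R ([l] @ (u @ winv u) @ [letter_inv l]) ([l] @ [] @ [letter_inv l])"
    by (rule cong_context[OF Cons])
  then show ?case
    using cong_cancel cong_trans by (fastforce simp: winv_def)
qed simp

lemma cong_winv_left: "cong R (winv u @ u) []"
  using cong_winv_right[of R "winv u"] by simp

lemma cong_cancel_left: "cong R (u @ v) (u @ v') \<Longrightarrow> cong R v v'"
proof -
  assume "cong R (u @ v) (u @ v')"
  then have 1: "cong R ((winv u @ u) @ v) ((winv u @ u) @ v')"
    using cong_append[of R "winv u" "winv u" "u @ v" "u @ v'"] by simp
  have 2: "cong R ((winv u @ u) @ x) x" for x
    using cong_append[OF cong_winv_left[of R u] cong_refl[of R x]] by simp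
  show ?thesis
    using 1 2[of v] 2[of v'] by (meson cong_sym cong_trans)
qed

lemma cong_cancel_right: "cong R (u @ v) (u' @ v) \<Longrightarrow> cong R u u'"
proof -
  assume "cong R (u @ v) (u' @ v)"
  then have 1: "cong R (u @ v @ winv v) (u' @ v @ winv v)"
    using cong_append[of R "u @ v" "u' @ v" "winv v" "winv v"] by simp
  have 2: "cong R (x @ v @ winv v) x" for x
    using cong_append[OF cong_refl[of R x] cong_winv_right[of R v]] by simp
  show ?thesis
    using 1 2[of u] 2[of u'] by (meson cong_sym cong_trans)
qed

lemma cong_iff_winv: "cong R u v \<longleftrightarrow> cong R (u @ winv v) []"
  using cong_append[of R u v "winv v" "winv v"] cong_winv_right[of R v] cong_cancel_right[of R u "winv v" v]
  by (meson cong_refl cong_sym cong_trans)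

lemma cong_winv: "cong R u v \<Longrightarrow> cong R (winv u) (winv v)"
proof -
  assume "cong R u v"
  then have "cong R (u @ winv u) (u @ winv v)"
    using cong_winv_right[of R u] cong_iff_winv[of R u v] by (meson cong_sym cong_trans)
  then show ?thesis by (rule cong_cancel_left)
qed

lemma cong_mono: "cong R u v \<Longrightarrow> R \<subseteq> R' \<Longrightarrow> cong R' u v"
proof (induction rule: cong.induct)
  case (cong_context u v x y)
  then show ?case by (auto intro: cong.cong_context)
qed (auto intro: cong.intros)

text \<open>A derivation uses finitely many relators. This cuts the infinite family of shifted
  relators down to a finite chain of amalgams.\<close>

lemma cong_finite: "cong R u v \<Longrightarrow> \<exists>S\<subseteq>R. finite S \<and> cong S u v"
proof (induction rule: cong.induct)
  case (cong_trans u v w)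
  then obtain S T where "S \<subseteq> R" "T \<subseteq> R" "finite S" "finite T" "cong S u v" "cong T v w"
    by blast
  then show ?case
    by (intro exI[of _ "S \<union> T"]) (auto intro: cong.cong_trans cong_mono)
next
  case (cong_relator r)
  then show ?case by (intro exI[of _ "{r}"]) (auto intro: cong.cong_relator)
next
  case (cong_context u v x y)
  then show ?case by (meson cong.cong_context)
next
  case (cong_sym u v)
  then show ?case by (meson cong.cong_sym)
qed (auto intro!: exI[of _ "{}"] cong_cancel)

lemma cong_free_reduce: "cong R u (free_reduce u)"
proof (induction u)
  case (Cons l u)
  have "cong R (l # v) (cancel_cons l v)" for v
  proof (cases "\<exists>v'. v = letter_inv l # v'")
    case True
    then show ?thesis
      using cong_append[OF cong_cancel[of R l] cong_refl] by auto
  qed (cases v; auto)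
  moreover have "cong R (l # u) (l # free_reduce u)"
    using cong_append[OF cong_refl[of R "[l]"] Cons] by simp
  ultimately show ?case
    by (auto simp: free_reduce_def intro: cong_trans)
qed (simp add: free_reduce_def)

lemma cong_empty_free_reduce: "cong {} u v \<Longrightarrow> free_reduce u = free_reduce v"
proof (induction rule: cong.induct)
  case (cong_context u v x y)
  then show ?case by (metis free_reduce_append_left free_reduce_append_right)
next
  case (cong_cancel l)
  then show ?case by (simp add: free_reduce_def)
qed auto

lemma cong_empty_reduced: "cong {} u v \<Longrightarrow> reduced u \<Longrightarrow> reduced v \<Longrightarrow> u = v"
  using cong_empty_free_reduce free_reduce_id by metis

lemma words_free_reduce: "u \<in> words X \<Longrightarrow> free_reduce u \<in> words X"
  using set_free_reduce[of u] by (auto simp: words_def)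

lemma cong_relabel: "cong R u v \<Longrightarrow> cong (relabel f ` R) (relabel f u) (relabel f v)"
proof (induction rule: cong.induct)
  case (cong_context u v x y)
  then show ?case by (auto simp: relabel_def intro: cong.cong_context)
next
  case (cong_cancel l)
  then show ?case
    using cong.cong_cancel[of "relabel f ` R" "(f (fst l), snd l)"]
    by (simp add: relabel_def letter_inv_def case_prod_beta)
qed (auto intro: cong.intros simp: relabel_def)

lemma relabel_append [simp]: "relabel f (u @ v) = relabel f u @ relabel f v"
  by (simp add: relabel_def)

lemma relabel_Nil [simp]: "relabel f [] = []"
  by (simp add: relabel_def)

lemma relabel_Cons: "relabel f (l # u) = (f (fst l), snd l) # relabel f u"
  by (simp add: relabel_def case_prod_beta)

lemma length_relabel [simp]: "length (relabel f u) = length u"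
  by (simp add: relabel_def)

lemma relabel_relabel: "relabel f (relabel g u) = relabel (\<lambda>x. f (g x)) u"
  by (simp add: relabel_def case_prod_beta)

lemma relabel_cong: "u \<in> words X \<Longrightarrow> (\<And>x. x \<in> X \<Longrightarrow> f x = g x) \<Longrightarrow> relabel f u = relabel g u"
  by (induction u) (auto simp: relabel_Cons)

lemma relabel_id: "u \<in> words X \<Longrightarrow> (\<And>x. x \<in> X \<Longrightarrow> f x = x) \<Longrightarrow> relabel f u = u"
  by (induction u) (auto simp: relabel_Cons)

lemma words_relabel: "u \<in> words X \<Longrightarrow> relabel f u \<in> words (f ` X)"
  by (induction u) (auto simp: relabel_Cons)

lemma words_relabelE:
  assumes "u \<in> words (f ` X)"
  obtains v where "v \<in> words X" "u = relabel f v"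
proof -
  have "\<exists>v\<in>words X. u = relabel f v"
    using assms
  proof (induction u)
    case (Cons l u)
    then obtain v x where "v \<in> words X" "u = relabel f v" "x \<in> X" "fst l = f x" by auto
    then show ?case
      by (intro bexI[of _ "(x, snd l) # v"]) (auto simp: relabel_Cons prod_eq_iff)
  qed (auto intro: bexI[of _ "[]"])
  then show thesis using that by blast
qed

text \<open>The map \<open>inv_into X f\<close> is again a relabelling and undoes \<open>f\<close>
  on words over \<open>X\<close>. It transports every derivation, even one that passes through
  letters outside the image of \<open>X\<close>.\<close>

lemma cong_relabel_iff:
  assumes f: "inj_on f X" and R: "R \<subseteq> words X" and u: "u \<in> words X" and v: "v \<in> words X"
  shows "cong (relabel f ` R) (relabel f u) (relabel f v) \<longleftrightarrow> cong R u v"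
proof
  have *: "relabel (inv_into X f) (relabel f w) = w" if "w \<in> words X" for w
    using that f by (auto simp: relabel_relabel intro: relabel_id)
  assume "cong (relabel f ` R) (relabel f u) (relabel f v)"
  then have "cong (relabel (inv_into X f) ` relabel f ` R) u v"
    using cong_relabel[of _ "relabel f u" "relabel f v" "inv_into X f"] u v by (simp add: *)
  moreover have "relabel (inv_into X f) ` relabel f ` R = R"
    using R * by (force simp: image_image)
  ultimately show "cong R u v" by simp
qed (rule cong_relabel)

text \<open>The letters of \<open>X\<close> are a basis of a free subgroup of the group presented by
  \<open>R\<close>.\<close>

definition free_mod :: "'a word set \<Rightarrow> 'a set \<Rightarrow> bool" where
  "free_mod R X \<longleftrightarrow> (\<forall>u\<in>words X. cong R u [] \<longrightarrow> cong {} u [])"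

lemma free_mod_subset: "free_mod R X \<Longrightarrow> Y \<subseteq> X \<Longrightarrow> free_mod R Y"
  unfolding free_mod_def using words_mono by blast

lemma free_modI:
  assumes "\<And>u. u \<in> words X \<Longrightarrow> reduced u \<Longrightarrow> cong R u [] \<Longrightarrow> u = []"
  shows "free_mod R X"
  unfolding free_mod_def
proof (intro ballI impI)
  fix u assume u: "u \<in> words X" "cong R u []"
  then have "free_reduce u = []"
    using cong_trans[OF cong_sym[OF cong_free_reduce[of R u]]]
    by (intro assms words_free_reduce reduced_free_reduce)
  then show "cong {} u []" using cong_free_reduce[of "{}" u] by simp
qed

lemma free_modD: "free_mod R X \<Longrightarrow> u \<in> words X \<Longrightarrow> cong R u [] \<Longrightarrow> cong {} u []"
  by (simp add: free_mod_def)

lemma free_mod_iff: "free_mod R X \<Longrightarrow> u \<in> words X \<Longrightarrow> cong R u [] \<longleftrightarrow> cong {} u []"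
  using free_modD cong_mono by blast

lemma free_mod_relabel:
  assumes "inj_on f Z" "R \<subseteq> words Z" "X \<subseteq> Z" "free_mod R X"
  shows "free_mod (relabel f ` R) (f ` X)"
  unfolding free_mod_def
proof (intro ballI impI)
  fix u assume "u \<in> words (f ` X)" and u: "cong (relabel f ` R) u []"
  then obtain v where v: "v \<in> words X" "u = relabel f v" by (auto elim: words_relabelE)
  then have "cong R v []"
    using u cong_relabel_iff[OF assms(1,2), of v "[]"] assms(3) words_mono by auto
  then have "cong {} v []" using assms(4) v free_modD by blast
  then show "cong {} u []" using cong_relabel[of "{}" v "[]" f] v by simp
qed

lemma free_mod_relabelD:
  assumes f: "inj f" and free: "free_mod (relabel f ` R) (f ` X)"
  shows "free_mod R X"
  unfolding free_mod_def
proof (intro ballI impI)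
  fix u assume u: "u \<in> words X" "cong R u []"
  then have "cong {} (relabel f u) []"
    using cong_relabel[OF u(2), of f] words_relabel[OF u(1), of f] free by (auto dest: free_modD)
  then show "cong {} u []"
    using cong_relabel_iff[OF f, of "{}" u "[]"] by (simp add: words_def)
qed

lemma reduced_relabel: "inj f \<Longrightarrow> reduced (relabel f u) \<longleftrightarrow> reduced u"
proof (induction u)
  case (Cons l u)
  then show ?case
    by (cases u) (auto simp: relabel_Cons reduced_Cons letter_inv_def inj_eq prod_eq_iff)
qed simp

lemma involves_iff: "involves u x \<longleftrightarrow> x \<in> fst ` set u"
  by (induction u) (auto simp: involves_def prod_eq_iff)

lemma involves_Nil [simp]: "\<not> involves [] x"
  by (simp add: involves_def)

lemma involves_Cons [simp]: "involves (l # u) x \<longleftrightarrow> fst l = x \<or> involves u x"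
  by (auto simp: involves_iff)

lemma involves_append [simp]: "involves (u @ v) x \<longleftrightarrow> involves u x \<or> involves v x"
  by (auto simp: involves_iff)

lemma involves_relabel: "involves (relabel f u) y \<longleftrightarrow> (\<exists>x. involves u x \<and> y = f x)"
  by (induction u) (auto simp: relabel_Cons)

lemma words_iff_involves: "u \<in> words X \<longleftrightarrow> (\<forall>x. involves u x \<longrightarrow> x \<in> X)"
  by (auto simp: words_def involves_iff)

section \<open>Amalgams\<close>

text \<open>\<open>agree\<close> says that the shared letters generate the same group in both
  factors, matched letter by letter. Indexing by \<open>bool\<close> lets one argument serve both
  factors.\<close>

locale amalgam =
  fixes X :: "bool \<Rightarrow> 'a set" and R :: "bool \<Rightarrow> 'a word set"
  assumes relators: "R i \<subseteq> words (X i)"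
    and agree: "u \<in> words (X True \<inter> X False) \<Longrightarrow> cong (R True) u [] \<longleftrightarrow> cong (R False) u []"
begin

abbreviation Y :: "'a set" where "Y \<equiv> X True \<inter> X False"

abbreviation RR :: "'a word set" where "RR \<equiv> R True \<union> R False"

lemma Y_words: "u \<in> words Y \<Longrightarrow> u \<in> words (X i)"
  by (cases i) (auto simp: words_Int)

lemma agree_cong:
  assumes "u \<in> words Y" "v \<in> words Y"
  shows "cong (R i) u v \<longleftrightarrow> cong (R j) u v"
  using agree[of "u @ winv v"] assms by (cases i; cases j; simp add: cong_iff_winv[of _ u])

section \<open>Canonical words for the amalgamated subgroup and its cosets\<close>

definition canon :: "'a word \<Rightarrow> 'a word" where
  "canon u = (SOME v. v \<in> words Y \<and> cong (R True) u v)"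

text \<open>The choice is made with \<open>R True\<close>, but by \<open>agree\<close> it is valid
  in both factors. Both thus name an element of the amalgamated subgroup by the same word, and
  equality of elements becomes equality of words.\<close>

lemma canon:
  assumes "u \<in> words Y"
  shows "canon u \<in> words Y" "cong (R i) u (canon u)"
proof -
  have "canon u \<in> words Y \<and> cong (R True) u (canon u)"
    unfolding canon_def by (rule someI[of _ u]) (use assms in simp)
  then show "canon u \<in> words Y" "cong (R i) u (canon u)"
    using assms agree_cong[of u "canon u" i True] by auto
qed

lemma canon_eq:
  assumes "u \<in> words Y" "v \<in> words Y" "cong (R i) u v"
  shows "canon u = canon v"
proof -
  have "cong (R True) u v" using assms agree_cong by blast
  then have "cong (R True) u x \<longleftrightarrow> cong (R True) v x" for x
    by (meson cong_sym cong_trans)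
  then show ?thesis by (simp add: canon_def)
qed

definition coset :: "bool \<Rightarrow> 'a word \<Rightarrow> 'a word set" where
  "coset i u = {v \<in> words (X i). \<exists>y\<in>words Y. cong (R i) v (y @ u)}"

text \<open>The coset of the amalgamated subgroup itself gets \<open>[]\<close>, so that a syllable
  is trivial exactly when its representative is the empty word.\<close>

definition rep :: "bool \<Rightarrow> 'a word \<Rightarrow> 'a word" where
  "rep i u = (if [] \<in> coset i u then [] else SOME v. v \<in> coset i u)"

definition coeff :: "bool \<Rightarrow> 'a word \<Rightarrow> 'a word" where
  "coeff i u = canon (SOME y. y \<in> words Y \<and> cong (R i) u (y @ rep i u))"

lemma mem_cosetI: "v \<in> words (X i) \<Longrightarrow> y \<in> words Y \<Longrightarrow> cong (R i) v (y @ u) \<Longrightarrow> v \<in> coset i u"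
  by (auto simp: coset_def)

lemma coset_sym:
  assumes "u \<in> words (X i)" "v \<in> coset i u"
  shows "u \<in> coset i v"
proof -
  obtain y where y: "y \<in> words Y" "cong (R i) v (y @ u)"
    using assms by (auto simp: coset_def)
  have "cong (R i) (winv y @ v) ((winv y @ y) @ u)"
    using cong_append[OF cong_refl[of "R i" "winv y"] y(2)] by simp
  also have "cong (R i) \<dots> ([] @ u)"
    by (intro cong_append cong_winv_left) simp
  finally have "cong (R i) u (winv y @ v)" by (simp add: cong_sym)
  with y assms show ?thesis by (auto intro: mem_cosetI[of _ _ "winv y"])
qed

lemma coset_trans:
  assumes "v \<in> coset i u" "w \<in> coset i v"
  shows "w \<in> coset i u"
proof -
  obtain y z where y: "y \<in> words Y" "cong (R i) v (y @ u)" and z: "z \<in> words Y" "cong (R i) w (z @ v)"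
    using assms by (auto simp: coset_def)
  have "cong (R i) (z @ v) (z @ y @ u)"
    using y by (intro cong_append) auto
  then have "cong (R i) w ((z @ y) @ u)" using z(2) by (auto intro: cong_trans)
  with y z assms show ?thesis
    by (intro mem_cosetI[of _ _ "z @ y"]) (auto simp: coset_def)
qed

lemma coset_eq:
  assumes "u \<in> words (X i)" "v \<in> coset i u"
  shows "coset i v = coset i u"
  using assms coset_sym coset_trans by blast

lemma rep_in_coset: "u \<in> words (X i) \<Longrightarrow> rep i u \<in> coset i u"
  using someI[of "\<lambda>v. v \<in> coset i u" u] mem_cosetI[of u i "[]" u]
  by (auto simp: rep_def)

lemma rep_words: "u \<in> words (X i) \<Longrightarrow> rep i u \<in> words (X i)"
  using rep_in_coset by (auto simp: coset_def)

lemma rep_eq: "u \<in> words (X i) \<Longrightarrow> v \<in> coset i u \<Longrightarrow> rep i v = rep i u"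
  using coset_eq by (simp add: rep_def)

lemma rep_rep: "u \<in> words (X i) \<Longrightarrow> rep i (rep i u) = rep i u"
  using rep_eq rep_in_coset by blast

lemma rep_mult: "y \<in> words Y \<Longrightarrow> u \<in> words (X i) \<Longrightarrow> rep i (y @ u) = rep i u"
  by (intro rep_eq mem_cosetI[of _ _ y]) (auto intro: Y_words)

lemma rep_cong: "u \<in> words (X i) \<Longrightarrow> v \<in> words (X i) \<Longrightarrow> cong (R i) u v \<Longrightarrow> rep i u = rep i v"
  by (intro rep_eq mem_cosetI[of _ _ "[]"]) auto

lemma rep_eq_Nil_iff:
  assumes "u \<in> words (X i)"
  shows "rep i u = [] \<longleftrightarrow> (\<exists>y\<in>words Y. cong (R i) u y)"
proof
  assume "rep i u = []"
  then have "u \<in> coset i []"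
    using rep_in_coset[OF assms] coset_sym[OF assms] by fastforce
  then show "\<exists>y\<in>words Y. cong (R i) u y" by (auto simp: coset_def)
next
  assume "\<exists>y\<in>words Y. cong (R i) u y"
  then have "u \<in> coset i []" using assms by (auto simp: coset_def)
  then have "[] \<in> coset i u" by (rule coset_sym[rotated]) simp
  then show "rep i u = []" by (simp add: rep_def)
qed

lemma coeff:
  assumes "u \<in> words (X i)"
  shows "coeff i u \<in> words Y" "cong (R i) u (coeff i u @ rep i u)" "canon (coeff i u) = coeff i u"
proof -
  define y where "y = (SOME y. y \<in> words Y \<and> cong (R i) u (y @ rep i u))"
  have "\<exists>y. y \<in> words Y \<and> cong (R i) u (y @ rep i u)"
    using coset_sym[OF assms rep_in_coset[OF assms]] by (auto simp: coset_def)
  from someI_ex[OF this] have y: "y \<in> words Y" "cong (R i) u (y @ rep i u)"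
    by (auto simp: y_def)
  have c: "coeff i u = canon y" by (simp add: coeff_def y_def)
  show "coeff i u \<in> words Y" using y canon c by simp
  have "cong (R i) (y @ rep i u) (coeff i u @ rep i u)"
    using y canon c by (intro cong_append) auto
  with y show "cong (R i) u (coeff i u @ rep i u)" by (blast intro: cong_trans)
  show "canon (coeff i u) = coeff i u"
    using canon_eq[of "coeff i u" y i] canon(1)[of y] canon(2)[of y i] y c by (auto intro: cong_sym)
qed

lemma coeff_unique:
  assumes "u \<in> words (X i)" "y \<in> words Y" "cong (R i) u (y @ rep i u)"
  shows "coeff i u = canon y"
proof -
  have "cong (R i) (coeff i u @ rep i u) (y @ rep i u)"
    using coeff(2)[OF assms(1)] assms(3) by (meson cong_sym cong_trans)
  then have "cong (R i) (coeff i u) y" by (rule cong_cancel_right)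
  then show ?thesis using canon_eq coeff assms by metis
qed

lemma coeff_mult:
  assumes "y \<in> words Y" "u \<in> words (X i)"
  shows "coeff i (y @ u) = canon (y @ coeff i u)"
proof (rule coeff_unique)
  show "cong (R i) (y @ u) ((y @ coeff i u) @ rep i (y @ u))"
    using cong_append[OF cong_refl[of "R i" y] coeff(2)[OF assms(2)]] rep_mult[OF assms] by simp
qed (use assms coeff Y_words in auto)

lemma coeff_cong:
  assumes "u \<in> words (X i)" "v \<in> words (X i)" "cong (R i) u v"
  shows "coeff i u = coeff i v"
proof -
  have "cong (R i) v (coeff i u @ rep i v)"
    using assms coeff(2)[OF assms(1)] rep_cong[OF assms] by (metis cong_sym cong_trans)
  then have "coeff i v = canon (coeff i u)"
    using assms coeff by (intro coeff_unique) auto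
  then show ?thesis using coeff assms by simp
qed

lemma coeff_Y: "y \<in> words Y \<Longrightarrow> coeff i y = canon y"
proof (rule coeff_unique)
  assume "y \<in> words Y"
  then have "rep i y = []" using rep_eq_Nil_iff[of y i] Y_words by blast
  then show "cong (R i) y (y @ rep i y)" by simp
qed (auto intro: Y_words)

text \<open>
  The state \<open>(c, [(i\<^sub>1, t\<^sub>1), \<dots>, (i\<^sub>m, t\<^sub>m)])\<close> stands for the normal form \<open>c t\<^sub>1 \<cdots> t\<^sub>m\<close>:
  \<open>c\<close> represents an element of the amalgamated subgroup and the \<open>t\<^sub>j\<close> are nontrivial coset
  representatives taken alternately from the two factors.
\<close>

type_synonym 'b state = "'b word \<times> (bool \<times> 'b word) list"

fun alternating :: "(bool \<times> 'a word) list \<Rightarrow> bool" where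
  "alternating ((i, _) # (j, t) # ts) \<longleftrightarrow> i \<noteq> j \<and> alternating ((j, t) # ts)"
| "alternating _ \<longleftrightarrow> True"

definition starts :: "bool \<Rightarrow> (bool \<times> 'a word) list \<Rightarrow> bool" where
  "starts i ts \<longleftrightarrow> ts \<noteq> [] \<and> fst (hd ts) = i"

definition states :: "'a state set" where
  "states = {(c, ts). c \<in> words Y \<and> canon c = c \<and> alternating ts \<and>
     (\<forall>(i, t)\<in>set ts. t \<in> words (X i) \<and> rep i t = t \<and> t \<noteq> [])}"

section \<open>Action of words on normal forms\<close>

fun join :: "bool \<Rightarrow> 'a state \<Rightarrow> 'a state" where
  "join i (c, []) = (c, [])"
| "join i (c, (j, t) # ts) = (if i = j then (c @ t, ts) else (c, (j, t) # ts))"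

definition split :: "bool \<Rightarrow> 'a state \<Rightarrow> 'a state" where
  "split i = (\<lambda>(u, ts). (coeff i u, if rep i u = [] then ts else (i, rep i u) # ts))"

text \<open>Van der Waerden's trick. \<open>join i\<close> absorbs a leading syllable of factor
  \<open>i\<close> into the head, which then ranges over the whole factor; there multiplication by
  \<open>v\<close> is concatenation, and \<open>split i\<close> restores the normal form.\<close>

definition act :: "bool \<Rightarrow> 'a word \<Rightarrow> 'a state \<Rightarrow> 'a state" where
  "act i v s = (case join i s of (u, ts) \<Rightarrow> split i (v @ u, ts))"

definition joined :: "bool \<Rightarrow> 'a state set" where
  "joined i = {(u, ts). u \<in> words (X i) \<and> alternating ts \<and> \<not> starts i ts \<and>
     (\<forall>(i, t)\<in>set ts. t \<in> words (X i) \<and> rep i t = t \<and> t \<noteq> [])}"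

lemma alternating_Cons: "alternating ((i, t) # ts) \<longleftrightarrow> \<not> starts i ts \<and> alternating ts"
  by (cases ts) (auto simp: starts_def)

lemma join_joined: "s \<in> states \<Longrightarrow> join i s \<in> joined i"
proof -
  assume s: "s \<in> states"
  obtain c ts where cts: "s = (c, ts)" by force
  show ?thesis
  proof (cases ts)
    case Nil
    with s cts show ?thesis by (auto simp: states_def joined_def starts_def intro: Y_words)
  next
    case (Cons jt ts')
    obtain j t where "jt = (j, t)" by force
    with s cts Cons show ?thesis
      by (auto simp: states_def joined_def alternating_Cons starts_def intro: Y_words)
  qed
qed

lemma split_states: "s \<in> joined i \<Longrightarrow> split i s \<in> states"
  by (auto simp: joined_def states_def split_def alternating_Cons coeff rep_words rep_rep
      split: if_splits)

lemma split_cong: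
  "u \<in> words (X i) \<Longrightarrow> u' \<in> words (X i) \<Longrightarrow> cong (R i) u u' \<Longrightarrow> split i (u, ts) = split i (u', ts)"
  using rep_cong[of u i u'] coeff_cong[of u i u'] by (simp add: split_def)

lemma split_join:
  assumes "s \<in> states"
  shows "split i (join i s) = s"
proof -
  obtain c ts where cts: "s = (c, ts)" by force
  have c: "c \<in> words Y" "canon c = c" using assms cts by (auto simp: states_def)
  have *: "split i (c, ts') = (c, ts')" for ts'
    using coeff_Y[OF c(1)] rep_eq_Nil_iff[of c i] c Y_words by (auto simp: split_def)
  show ?thesis
  proof (cases "starts i ts")
    case True
    then obtain t ts' where ts: "ts = (i, t) # ts'"
      by (cases ts) (auto simp: starts_def)
    have t: "t \<in> words (X i)" "rep i t = t" "t \<noteq> []"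
      using assms cts ts by (auto simp: states_def)
    have "coeff i t = canon []" by (rule coeff_unique) (use t in auto)
    then have "coeff i (c @ t) = canon (c @ canon [])"
      using coeff_mult[OF c(1) t(1)] by simp
    also have "\<dots> = canon c"
      using cong_append[OF cong_refl[of "R i" c] cong_sym[OF canon(2)[of "[]" i]]] c canon
      by (intro canon_eq[of _ _ i]) auto
    finally show ?thesis
      using cts ts t c rep_mult[OF c(1) t(1)] by (simp add: split_def)
  next
    case False
    then have "join i s = s" using cts by (cases ts) (auto simp: starts_def)
    with * cts show ?thesis by simp
  qed
qed

lemma join_split:
  assumes "(u, ts) \<in> joined i"
  obtains u' where "join i (split i (u, ts)) = (u', ts)" "u' \<in> words (X i)" "cong (R i) u u'"
proof -
  have u: "u \<in> words (X i)" "\<not> starts i ts" using assms by (auto simp: joined_def)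
  have "join i (c, ts) = (c, ts)" for c
    using u(2) by (cases ts) (auto simp: starts_def)
  then show thesis
    using that coeff[OF u(1)] rep_words[OF u(1)] Y_words
    by (cases "rep i u = []") (force simp: split_def)+
qed

lemma act_states: "s \<in> states \<Longrightarrow> v \<in> words (X i) \<Longrightarrow> act i v s \<in> states"
proof -
  assume s: "s \<in> states" and v: "v \<in> words (X i)"
  obtain u ts where u: "join i s = (u, ts)" by force
  then have "(v @ u, ts) \<in> joined i" using join_joined[OF s, of i] v by (auto simp: joined_def)
  then show ?thesis using split_states u by (simp add: act_def)
qed

lemma act_append:
  assumes s: "s \<in> states" and v: "v \<in> words (X i)" "v' \<in> words (X i)"
  shows "act i (v @ v') s = act i v (act i v' s)"
proof -
  obtain u ts where u: "join i s = (u, ts)" by force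
  then have *: "(v' @ u, ts) \<in> joined i"
    using join_joined[OF s, of i] v by (auto simp: joined_def)
  then obtain u' where u': "join i (split i (v' @ u, ts)) = (u', ts)" "u' \<in> words (X i)"
    "cong (R i) (v' @ u) u'" by (rule join_split)
  have "act i v (act i v' s) = split i (v @ u', ts)" using u u' by (simp add: act_def)
  also have "\<dots> = split i (v @ v' @ u, ts)"
    using u' v * by (intro split_cong cong_append) (auto simp: joined_def intro: cong_sym)
  finally show ?thesis using u by (simp add: act_def)
qed

lemma act_cong:
  assumes s: "s \<in> states" and v: "v \<in> words (X i)" "v' \<in> words (X i)" "cong (R i) v v'"
  shows "act i v s = act i v' s"
proof -
  obtain u ts where u: "join i s = (u, ts)" by force
  then have "u \<in> words (X i)" using join_joined[OF s, of i] by (auto simp: joined_def)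
  then have "split i (v @ u, ts) = split i (v' @ u, ts)"
    using v by (intro split_cong cong_append) auto
  then show ?thesis using u by (simp add: act_def)
qed

lemma act_Nil: "s \<in> states \<Longrightarrow> act i [] s = s"
  using split_join[of s i] by (simp add: act_def split: prod.splits)

text \<open>The result does not depend on \<open>i\<close>: the amalgamated subgroup acts in the
  same way through both factors. This is what glues the two actions into one.\<close>

lemma act_Y:
  assumes s: "(c, ts) \<in> states" and y: "y \<in> words Y"
  shows "act i y (c, ts) = (canon (y @ c), ts)"
proof -
  obtain u ts' where u: "join i (c, ts) = (u, ts')" by force
  then have uX: "u \<in> words (X i)" using join_joined[OF s, of i] by (auto simp: joined_def)
  have sp: "split i (u, ts') = (c, ts)" using split_join[OF s, of i] u by simp
  have "coeff i (y @ u) = canon (y @ c)" "rep i (y @ u) = rep i u"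
    using coeff_mult[OF y uX] rep_mult[OF y uX] sp by (auto simp: split_def)
  then have "split i (y @ u, ts') = (canon (y @ c), ts)"
    using sp by (auto simp: split_def)
  then show ?thesis using u by (simp add: act_def)
qed

text \<open>If no syllable appeared, \<open>u @ c\<close> would lie in the amalgamated subgroup, and
  hence so would \<open>u\<close>, because \<open>c\<close> does.\<close>

lemma act_starts:
  assumes s: "(c, ts) \<in> states" and "\<not> starts i ts" and u: "u \<in> words (X i)"
    and "\<not> (\<exists>y\<in>words Y. cong (R i) u y)"
  shows "starts i (snd (act i u (c, ts)))"
proof -
  have j: "join i (c, ts) = (c, ts)" using assms(2) by (cases ts) (auto simp: starts_def)
  have c: "c \<in> words Y" using s by (simp add: states_def)
  have "rep i (u @ c) \<noteq> []"
  proof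
    assume "rep i (u @ c) = []"
    then obtain y where y: "y \<in> words Y" "cong (R i) (u @ c) y"
      using rep_eq_Nil_iff[of "u @ c" i] u c Y_words by auto
    have "cong (R i) (u @ c @ winv c) (y @ winv c)"
      using cong_append[OF y(2) cong_refl[of _ "winv c"]] by simp
    moreover have "cong (R i) (u @ c @ winv c) (u @ [])"
      by (intro cong_append cong_winv_right) simp
    ultimately have "cong (R i) u (y @ winv c)" by (auto intro: cong_trans cong_sym)
    with y c assms(4) show False by auto
  qed
  with j show ?thesis by (simp add: act_def split_def starts_def)
qed

text \<open>A shared letter may be sent through either factor, by \<open>act_Y\<close>. Letters of
  neither factor act trivially, which still respects cancellation.\<close>

definition act_letter :: "'a letter \<Rightarrow> 'a state \<Rightarrow> 'a state" where
  "act_letter l s = (if fst l \<in> X True then act True [l] s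
     else if fst l \<in> X False then act False [l] s else s)"

definition act_word :: "'a word \<Rightarrow> 'a state \<Rightarrow> 'a state" where
  "act_word u s = foldr act_letter u s"

lemma act_word_simps [simp]:
  "act_word [] s = s"
  "act_word (u @ v) s = act_word u (act_word v s)"
  by (simp_all add: act_word_def)

lemma act_letter: "s \<in> states \<Longrightarrow> fst l \<in> X i \<Longrightarrow> act_letter l s = act i [l] s"
  using act_Y[of "fst s" "snd s" "[l]"] by (cases i) (auto simp: act_letter_def)

lemma act_word_states: "s \<in> states \<Longrightarrow> act_word u s \<in> states"
  by (induction u) (auto simp: act_word_def act_letter_def act_states)

lemma act_word: "s \<in> states \<Longrightarrow> u \<in> words (X i) \<Longrightarrow> act_word u s = act i u s"
proof (induction u)
  case (Cons l u)
  then have "act_word (l # u) s = act i [l] (act i u s)"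
    using act_letter[of "act_word u s" l i] act_word_states[OF Cons.prems(1), of u]
    by (simp add: act_word_def)
  then show ?case using act_append[of s "[l]" i u] Cons.prems by simp
qed (simp add: act_Nil)

lemma act_word_cong: "cong RR u v \<Longrightarrow> s \<in> states \<Longrightarrow> act_word u s = act_word v s"
proof (induction arbitrary: s rule: cong.induct)
  case (cong_context u v x y)
  then show ?case by (simp add: act_word_states)
next
  case (cong_cancel l)
  show ?case
  proof (cases "\<exists>i. fst l \<in> X i")
    case True
    then obtain i where "fst l \<in> X i" by blast
    then show ?thesis
      using cong_cancel act_word[of s "[l, letter_inv l]" i] act_cong[of s "[l, letter_inv l]" i "[]"]
      by (simp add: act_Nil cong.cong_cancel)
  next
    case False
    then show ?thesis by (auto simp: act_word_def act_letter_def)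
  qed
next
  case (cong_relator r)
  then obtain i where "r \<in> R i" "r \<in> words (X i)" using relators by blast
  then show ?case
    using cong_relator act_word[of s r i] act_cong[of s r i "[]"]
    by (simp add: act_Nil cong.cong_relator)
qed simp_all

abbreviation base :: "'a state" where "base \<equiv> (canon [], [])"

lemma base: "base \<in> states"
  using canon_eq[of "[]" "canon []" True] canon(1)[of "[]"] canon(2)[of "[]" True] by (simp add: states_def)

lemma act_word_base: "u \<in> words (X i) \<Longrightarrow> act_word u base = split i (u @ canon [], [])"
  using act_word[OF base, of u i] by (simp add: act_def)

lemma words_canon: "u \<in> words (X i) \<Longrightarrow> u @ canon [] \<in> words (X i)"
  using Y_words canon by simp

lemma cong_canon: "cong (R i) (u @ canon []) u"
  using cong_append[OF cong_refl[of "R i" u] cong_sym[OF canon(2)[of "[]" i]]] by simp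

section \<open>Consequences of the normal form theorem\<close>

theorem embed:
  assumes "u \<in> words (X i)" "v \<in> words (X i)" "cong RR u v"
  shows "cong (R i) u v"
proof -
  \<comment> \<open>Both words are applied to the base state; the coefficient and the representative
    that result determine the element of the factor.\<close>
  have "split i (u @ canon [], []) = split i (v @ canon [], [])"
    using act_word_cong[OF assms(3) base] act_word_base assms by metis
  then have "coeff i (u @ canon []) = coeff i (v @ canon [])" "rep i (u @ canon []) = rep i (v @ canon [])"
    by (auto simp: split_def split: if_splits)
  then show ?thesis
    using coeff(2)[OF words_canon[OF assms(1)]] coeff(2)[OF words_canon[OF assms(2)]]
      cong_canon[of i u] cong_canon[of i v] by (metis cong_sym cong_trans)
qed

theorem inter:
  assumes "u \<in> words (X True)" "v \<in> words (X False)" "cong RR u v"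
  obtains y where "y \<in> words Y" "cong (R True) u y" "cong (R False) v y"
proof -
  have *: "split True (u @ canon [], []) = split False (v @ canon [], [])"
    using act_word_cong[OF assms(3) base] act_word_base assms by metis
  \<comment> \<open>A syllable would be tagged \<open>True\<close> on one side and
    \<open>False\<close> on the other, so there is none, and the element is given by the common
    coefficient.\<close>
  then have "rep True (u @ canon []) = []" "rep False (v @ canon []) = []"
    "coeff True (u @ canon []) = coeff False (v @ canon [])"
    by (auto simp: split_def split: if_splits)
  with that[of "coeff True (u @ canon [])"] show thesis
    using coeff[OF words_canon[OF assms(1)]] coeff[OF words_canon[OF assms(2)]]
      cong_canon[of True u] cong_canon[of False v] by (metis append_Nil2 cong_sym cong_trans)
qed

text \<open>\<open>away\<close> says that the subgroup on \<open>P i\<close> meets the amalgamated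
  subgroup trivially and, by taking \<open>y = []\<close>, that it is free. Read from the right,
  each maximal run of letters from one side then puts a new syllable in front, so a nonempty reduced
  word moves the base state.\<close>

theorem free_product:
  assumes PX: "\<And>i. P i \<subseteq> X i" and disjoint: "P True \<inter> P False = {}"
    and away: "\<And>i u y. u \<in> words (P i) \<Longrightarrow> y \<in> words Y \<Longrightarrow> cong (R i) u y \<Longrightarrow> cong {} u []"
  shows "free_mod RR (P True \<union> P False)"
proof -
  have main: "u \<in> words (P True \<union> P False) \<Longrightarrow> reduced u \<Longrightarrow> u \<noteq> [] \<Longrightarrow> fst (hd u) \<in> P j
    \<Longrightarrow> starts j (snd (act_word u base))" for u j
  proof (induction u arbitrary: j rule: length_induct)
    case (1 u)
    define v where "v = takeWhile (\<lambda>l. fst l \<in> P j) u"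
    define w where "w = dropWhile (\<lambda>l. fst l \<in> P j) u"
    have u: "u = v @ w" by (simp add: v_def w_def)
    have "v \<noteq> []" using 1 by (cases u) (auto simp: v_def)
    have v: "v \<in> words (P j)" by (auto simp: v_def words_def dest: set_takeWhileD)
    have red: "reduced v" "reduced w"
      using 1(3) unfolding u reduced_append by auto
    have "\<not> starts j (snd (act_word w base))"
    proof (cases "w = []")
      case False
      then have "fst (hd w) \<notin> P j" unfolding w_def by (rule hd_dropWhile)
      moreover have "fst (hd w) \<in> P True \<union> P False"
        using False 1(2) u by (cases w) auto
      ultimately have "fst (hd w) \<in> P (\<not> j)" by (cases j) auto
      moreover have "w \<in> words (P True \<union> P False)" using 1(2) u by simp
      ultimately have "starts (\<not> j) (snd (act_word w base))"
        using 1(1) False red \<open>v \<noteq> []\<close> u by auto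
      then show ?thesis by (auto simp: starts_def)
    qed (simp add: starts_def)
    moreover have "\<not> (\<exists>y\<in>words Y. cong (R j) v y)"
      using away[OF v] cong_empty_reduced[of v "[]"] red \<open>v \<noteq> []\<close> by auto
    ultimately have "starts j (snd (act j v (act_word w base)))"
      using act_starts[of "fst (act_word w base)" "snd (act_word w base)" j v]
        act_word_states[OF base, of w] words_mono[OF v PX] by simp
    then show ?case
      using act_word[OF act_word_states[OF base, of w] words_mono[OF v PX]] u by simp
  qed
  show ?thesis
  proof (rule free_modI, rule ccontr)
    fix u assume u: "u \<in> words (P True \<union> P False)" "reduced u" "cong RR u []" "u \<noteq> []"
    then obtain j where "fst (hd u) \<in> P j" by (cases u) auto
    with main[OF u(1,2,4)] have "starts j (snd (act_word u base))" .
    moreover have "act_word u base = base" using act_word_cong[OF u(3) base] by simp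
    ultimately show False by (simp add: starts_def)
  qed
qed

end

section \<open>Chains of amalgams\<close>

lemma amalgam_over_free:
  assumes "R \<subseteq> words X" "S \<subseteq> words Z" "free_mod R (X \<inter> Z)" "free_mod S (X \<inter> Z)"
  shows "amalgam (\<lambda>i. if i then X else Z) (\<lambda>i. if i then R else S)"
  using assms by unfold_locales (auto simp: free_mod_iff split: if_splits)

locale free_amalgam =
  fixes X Z :: "'a set" and R S :: "'a word set"
  assumes words: "R \<subseteq> words X" "S \<subseteq> words Z"
    and free: "free_mod R (X \<inter> Z)" "free_mod S (X \<inter> Z)"
begin

interpretation amalgam "\<lambda>i. if i then X else Z" "\<lambda>i. if i then R else S"
  by (intro amalgam_over_free words free)

lemma embed_left: "u \<in> words X \<Longrightarrow> v \<in> words X \<Longrightarrow> cong (R \<union> S) u v \<Longrightarrow> cong R u v"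
  using embed[of u True v] by simp

lemma embed_right: "u \<in> words Z \<Longrightarrow> v \<in> words Z \<Longrightarrow> cong (R \<union> S) u v \<Longrightarrow> cong S u v"
  using embed[of u False v] by simp

lemma inter_cong:
  assumes "u \<in> words X" "v \<in> words Z" "cong (R \<union> S) u v"
  obtains y where "y \<in> words (X \<inter> Z)" "cong R u y" "cong S v y"
  using inter[of u v] assms by auto

lemma free_product_free:
  assumes "P \<subseteq> X" "Q \<subseteq> Z" "P \<inter> Q = {}"
    and "\<And>u y. u \<in> words P \<Longrightarrow> y \<in> words (X \<inter> Z) \<Longrightarrow> cong R u y \<Longrightarrow> cong {} u []"
    and "\<And>u y. u \<in> words Q \<Longrightarrow> y \<in> words (X \<inter> Z) \<Longrightarrow> cong S u y \<Longrightarrow> cong {} u []"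
  shows "free_mod (R \<union> S) (P \<union> Q)"
proof -
  have "cong {} u []"
    if "u \<in> words (if i then P else Q)" "y \<in> words (X \<inter> Z)" "cong (if i then R else S) u y" for i u y
    using that assms(4,5)[of u y] by (cases i) simp_all
  then show ?thesis
    using free_product[of "\<lambda>i. if i then P else Q"] assms(1-3) by simp
qed

end

text \<open>By \<open>interval\<close> a letter occupies consecutive pieces, so an arc meets the
  next piece only in the letters shared with its own last piece. The overlap is free on both sides,
  which is all that gluing requires.\<close>

locale chain =
  fixes X :: "nat \<Rightarrow> 'a set" and r :: "nat \<Rightarrow> 'a word"
  assumes r_words: "r i \<in> words (X i)"
    and interval: "i \<le> m \<Longrightarrow> m \<le> j \<Longrightarrow> X i \<inter> X j \<subseteq> X m"
    and free_left: "free_mod {r i} (X i \<inter> X (Suc i))"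
    and free_right: "free_mod {r (Suc i)} (X i \<inter> X (Suc i))"
begin

definition letters :: "nat \<Rightarrow> nat \<Rightarrow> 'a set" where
  "letters p q = (\<Union>i\<in>{p..q}. X i)"

lemma letters_Int:
  assumes "p \<le> q" "q < s"
  shows "letters p q \<inter> letters (Suc q) s = X q \<inter> X (Suc q)"
proof
  show "letters p q \<inter> letters (Suc q) s \<subseteq> X q \<inter> X (Suc q)"
  proof
    fix x assume "x \<in> letters p q \<inter> letters (Suc q) s"
    then obtain i j where "i \<le> q" "Suc q \<le> j" "x \<in> X i" "x \<in> X j"
      by (auto simp: letters_def)
    then show "x \<in> X q \<inter> X (Suc q)"
      using interval[of i q j] interval[of i "Suc q" j] by auto
  qed
  show "X q \<inter> X (Suc q) \<subseteq> letters p q \<inter> letters (Suc q) s"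
    using assms by (force simp: letters_def)
qed

lemma relators_words: "r ` {p..q} \<subseteq> words (letters p q)"
  using r_words by (auto simp: letters_def intro!: words_mono[OF r_words])

text \<open>Embedding and gluing are one induction: once piece \<open>q\<close> embeds in the arc
  ending at \<open>q\<close>, its overlap with piece \<open>Suc q\<close> is free in the whole arc,
  so the next amalgam exists.\<close>

lemma embed_piece:
  assumes "p \<le> i" "i \<le> q" "u \<in> words (X i)" "v \<in> words (X i)" "cong (r ` {p..q}) u v"
  shows "cong {r i} u v"
proof -
  have "p \<le> q" using assms by simp
  then show ?thesis
    using assms
  proof (induction q arbitrary: i u v rule: dec_induct)
    case base
    then show ?case by simp
  next
    case (step q)
    have eq: "r ` {p..Suc q} = r ` {p..q} \<union> {r (Suc q)}"
      using step.hyps by (auto simp: atLeastAtMostSuc_conv)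
    have int: "letters p q \<inter> X (Suc q) = X q \<inter> X (Suc q)"
      using letters_Int[of p q "Suc q"] step.hyps by (simp add: letters_def)
    have "free_mod (r ` {p..q}) (X q \<inter> X (Suc q))"
      unfolding free_mod_def
    proof (intro ballI impI)
      fix u assume u: "u \<in> words (X q \<inter> X (Suc q))" "cong (r ` {p..q}) u []"
      then have "cong {r q} u []" using step.IH[of q u "[]"] step.hyps by (simp add: words_Int)
      then show "cong {} u []" using free_left u free_modD by blast
    qed
    then interpret free_amalgam "letters p q" "X (Suc q)" "r ` {p..q}" "{r (Suc q)}"
      using relators_words r_words free_right by unfold_locales (simp_all add: int)
    show ?case
    proof (cases "i = Suc q")
      case True
      then show ?thesis using embed_right step.prems eq by simp
    next
      case False
      then have i: "i \<le> q" using step.prems by simp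
      then have "X i \<subseteq> letters p q"
        using step.prems by (auto simp: letters_def)
      then have "words (X i) \<subseteq> words (letters p q)"
        using words_mono by blast
      then show ?thesis
        using embed_left[of u v] step.prems step.IH[of i u v] eq i by auto
    qed
  qed
qed

lemma free_piece:
  assumes "p \<le> i" "i \<le> q" "V \<subseteq> X i" "free_mod {r i} V"
  shows "free_mod (r ` {p..q}) V"
  unfolding free_mod_def
proof (intro ballI impI)
  fix u assume "u \<in> words V" "cong (r ` {p..q}) u []"
  then show "cong {} u []"
    using embed_piece[OF assms(1,2), of u "[]"] assms(3,4) words_mono free_modD by fastforce
qed

lemma split:
  assumes "p \<le> q" "q < s"
  shows "free_amalgam (letters p q) (letters (Suc q) s) (r ` {p..q}) (r ` {Suc q..s})"
  using assms relators_words free_left free_right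
  by unfold_locales (auto simp: letters_Int intro!: free_piece)

end

section \<open>Shifted relators on the integers\<close>

abbreviation shift :: "int \<Rightarrow> ('a \<times> int) word \<Rightarrow> ('a \<times> int) word" where
  "shift j \<equiv> relabel (\<lambda>(y, i). (y, i + j))"

text \<open>The shifts form a chain in which only the window of indices of the letter
  \<open>s\<close> moves; all other letters lie in every piece. Adjacent windows overlap without the
  lowest \<open>s\<close> of one relator and the highest \<open>s\<close> of the other.
  \<open>V\<close> fits into window \<open>j0\<close> and misses one of its ends.\<close>

lemma free_mod_shifts:
  fixes v :: "('a \<times> int) word"
  assumes free: "\<And>x. involves v x \<Longrightarrow> free_mod {v} (- {x})"
    and low: "involves v (s, lo)" and high: "involves v (s, hi)"
    and bounds: "\<And>i. involves v (s, i) \<Longrightarrow> lo \<le> i \<and> i \<le> hi"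
    and V: "V \<subseteq> {(y, i). y = s \<longrightarrow> lo + j0 \<le> i \<and> i \<le> hi + j0}"
    and omit: "(s, lo + j0) \<notin> V \<or> (s, hi + j0) \<notin> V"
  shows "free_mod (range (\<lambda>j. shift j v)) V"
proof -
  have free_shift: "free_mod {shift j v} U" if "involves v (s, i)" "(s, i + j) \<notin> U" for i j U
  proof -
    let ?f = "\<lambda>(y :: 'a, i). (y, i + j)"
    have "bij ?f"
      by (rule bij_betw_byWitness[where f' = "\<lambda>(y, i). (y, i - j)"]) auto
    then have "?f ` (- {(s, i)}) = - {(s, i + j)}"
      by (simp add: bij_image_Compl_eq)
    moreover have "free_mod (relabel ?f ` {v}) (?f ` (- {(s, i)}))"
      using \<open>bij ?f\<close> free[OF that(1)]
      by (intro free_mod_relabel[of _ UNIV]) (auto simp: bij_def words_def)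
    ultimately show ?thesis using that(2) by (auto intro: free_mod_subset)
  qed
  define X where "X j = {(y :: 'a, i). y = s \<longrightarrow> lo + j \<le> i \<and> i \<le> hi + j}" for j
  have v: "shift j v \<in> words (X j)" for j
    unfolding words_iff_involves
  proof (intro allI impI)
    fix x assume "involves (shift j v) x"
    then obtain y i where "involves v (y, i)" "x = (y, i + j)"
      by (auto simp: involves_relabel)
    then show "x \<in> X j" using bounds by (auto simp: X_def)
  qed
  show ?thesis
    unfolding free_mod_def
  proof (intro ballI impI)
    fix u assume u: "u \<in> words V" "cong (range (\<lambda>j. shift j v)) u []"
    then obtain S where S: "S \<subseteq> range (\<lambda>j. shift j v)" "finite S" "cong S u []"
      using cong_finite by blast
    from finite_subset_image[OF S(2,1)]
    obtain J where J: "finite J" "S = (\<lambda>j. shift j v) ` J" by blast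
    \<comment> \<open>All shifts in use, and \<open>j0\<close>, lie between \<open>-m\<close> and
      \<open>m\<close>; the offset \<open>m\<close> turns them into indices of a chain numbered from
      0.\<close>
    define m where "m = nat (Max (abs ` insert j0 J))"
    have m: "\<bar>j\<bar> \<le> int m" if "j \<in> insert j0 J" for j
    proof -
      have "\<bar>j\<bar> \<le> Max (abs ` insert j0 J)" using J that by (intro Max_ge) auto
      then show ?thesis unfolding m_def by linarith
    qed
    interpret chain "\<lambda>i. X (int i - int m)" "\<lambda>i. shift (int i - int m) v"
    proof
      show "X (int i - int m) \<inter> X (int j - int m) \<subseteq> X (int k - int m)"
        if "i \<le> k" "k \<le> j" for i j k
        using that by (auto simp: X_def)
      show "free_mod {shift (int i - int m) v} (X (int i - int m) \<inter> X (int (Suc i) - int m))" for i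
        by (rule free_shift[OF low]) (auto simp: X_def)
      show "free_mod {shift (int (Suc i) - int m) v} (X (int i - int m) \<inter> X (int (Suc i) - int m))" for i
        by (rule free_shift[OF high]) (auto simp: X_def)
    qed (rule v)
    have "S \<subseteq> (\<lambda>i. shift (int i - int m) v) ` {0..2 * m}"
    proof
      fix w assume "w \<in> S"
      then obtain j where j: "j \<in> J" "w = shift j v" using J by blast
      then show "w \<in> (\<lambda>i. shift (int i - int m) v) ` {0..2 * m}"
        using m[of j] by (intro image_eqI[of _ _ "nat (j + int m)"]) auto
    qed
    then have "cong ((\<lambda>i. shift (int i - int m) v) ` {0..2 * m}) u []"
      using S(3) cong_mono by blast
    moreover have "free_mod ((\<lambda>i. shift (int i - int m) v) ` {0..2 * m}) V"
    proof (rule free_piece[of _ "nat (j0 + int m)"])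
      show "V \<subseteq> X (int (nat (j0 + int m)) - int m)"
        using V m[of j0] by (auto simp: X_def)
      show "free_mod {shift (int (nat (j0 + int m)) - int m) v} V"
        using omit m[of j0] free_shift[OF low, of j0 V] free_shift[OF high, of j0 V] by auto
    qed (use m[of j0] in auto)
    ultimately show "cong {} u []" using u free_modD by blast
  qed
qed

section \<open>The Freiheitssatz\<close>

definition weight :: "('a \<Rightarrow> int) \<Rightarrow> 'a word \<Rightarrow> int" where
  "weight \<phi> u = (\<Sum>l\<leftarrow>u. if snd l then \<phi> (fst l) else - \<phi> (fst l))"

lemma weight_simps [simp]:
  "weight \<phi> [] = 0"
  "weight \<phi> (l # u) = (if snd l then \<phi> (fst l) else - \<phi> (fst l)) + weight \<phi> u"
  "weight \<phi> (u @ v) = weight \<phi> u + weight \<phi> v"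
  by (simp_all add: weight_def)

lemma weight_cong: "cong R u v \<Longrightarrow> (\<And>r. r \<in> R \<Longrightarrow> weight \<phi> r = 0) \<Longrightarrow> weight \<phi> u = weight \<phi> v"
  by (induction rule: cong.induct) (auto simp: letter_inv_def)

abbreviation exponent :: "'a \<Rightarrow> 'a word \<Rightarrow> int" where
  "exponent x \<equiv> weight (\<lambda>y. if y = x then 1 else 0)"

lemma weight_two:
  assumes "a \<noteq> b"
  shows "weight (\<lambda>y. if y = a then p else if y = b then q else 0) u = p * exponent a u + q * exponent b u"
  using assms by (induction u) (auto simp: algebra_simps)

lemma reduced_single_letter:
  assumes "reduced u" "u \<in> words {a}" "u \<noteq> []"
  shows "weight \<phi> u = (if snd (hd u) then 1 else - 1) * int (length u) * \<phi> a"
  using assms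
proof (induction u)
  case (Cons l u)
  show ?case
  proof (cases u)
    case (Cons m u')
    then have "snd m = snd l"
      using Cons.prems by (auto simp: letter_inv_def prod_eq_iff)
    then show ?thesis using Cons.IH Cons.prems Cons by (auto simp: algebra_simps)
  qed (use Cons.prems in simp)
qed simp

lemma weight_run_neq_0:
  assumes "reduced u" "u \<in> words {a}" "u \<noteq> []" "\<phi> a \<noteq> 0"
  shows "weight \<phi> u \<noteq> 0"
  using reduced_single_letter[OF assms(1-3), of \<phi>] assms by auto

text \<open>
  The Reidemeister--Schreier rewriting of \<open>u\<close>, started at height \<open>p\<close>: a letter \<open>y\<close> of weight
  \<open>\<phi> y\<close> read at height \<open>h\<close> raises the height to \<open>h + \<phi> y\<close> and contributes the kernel generator
  \<open>(y, h)\<close>; the letter \<open>a\<close> only changes the height.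
\<close>

fun unwind :: "('a \<Rightarrow> int) \<Rightarrow> 'a \<Rightarrow> int \<Rightarrow> 'a word \<Rightarrow> ('a \<times> int) word" where
  "unwind \<phi> a p [] = []"
| "unwind \<phi> a p (l # u) =
     (if fst l = a then [] else [((fst l, if snd l then p else p - \<phi> (fst l)), snd l)])
     @ unwind \<phi> a (p + weight \<phi> [l]) u"

lemma unwind_append: "unwind \<phi> a p (u @ v) = unwind \<phi> a p u @ unwind \<phi> a (p + weight \<phi> u) v"
  by (induction u arbitrary: p) (auto simp: algebra_simps)

lemma unwind_shift: "unwind \<phi> a (p + j) u = shift j (unwind \<phi> a p u)"
proof (induction u arbitrary: p)
  case (Cons l u)
  then show ?case
    using Cons[of "p + weight \<phi> [l]"] by (auto simp: relabel_Cons algebra_simps)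
qed simp

lemma length_unwind: "length (unwind \<phi> a p u) \<le> length u"
  by (induction u arbitrary: p) (auto simp: le_SucI)

lemma length_unwind_less: "involves u a \<Longrightarrow> length (unwind \<phi> a p u) < length u"
  by (induction u arbitrary: p) (auto simp: le_imp_less_Suc length_unwind)

lemma involves_unwind: "involves u x \<Longrightarrow> x \<noteq> a \<Longrightarrow> \<exists>i. involves (unwind \<phi> a p u) (x, i)"
  by (induction u arbitrary: p) auto

lemma involves_unwindD: "involves (unwind \<phi> a p u) (x, i) \<Longrightarrow> involves u x \<and> x \<noteq> a"
  by (induction u arbitrary: p) (auto split: if_splits)

lemma unwind_eq_Nil: "unwind \<phi> a p u = [] \<longleftrightarrow> u \<in> words {a}"
  by (induction u arbitrary: p) auto

text \<open>Read at height \<open>p\<close>, the relator becomes its rewriting shifted by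
  \<open>p\<close>. Having weight 0, it leaves the height of all that follows unchanged.\<close>

lemma unwind_cong:
  assumes "cong {w} u v" "weight \<phi> w = 0"
  shows "cong (range (\<lambda>j. shift j (unwind \<phi> a 0 w))) (unwind \<phi> a p u) (unwind \<phi> a p v)"
  using assms(1)
proof (induction arbitrary: p rule: cong.induct)
  case (cong_context u v x y)
  have "weight \<phi> u = weight \<phi> v"
    using weight_cong[OF cong_context.hyps] assms(2) by simp
  then show ?case
    using cong.cong_context[OF cong_context.IH] by (simp add: unwind_append)
next
  case (cong_cancel l)
  then show ?case
    using cong.cong_cancel[of _ "((fst l, if snd l then p else p - \<phi> (fst l)), snd l)"]
    by (auto simp: letter_inv_def)
next
  case (cong_relator r)
  then have "unwind \<phi> a p r = shift p (unwind \<phi> a 0 w)"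
    using unwind_shift[of \<phi> a 0 p w] by simp
  then show ?case by (auto intro: cong.cong_relator)
qed (auto intro: cong.intros)

lemma unwind_Cons:
  assumes "unwind \<phi> a p u = m # v"
  obtains x l u' where "u = x @ l # u'" "x \<in> words {a}" "fst l \<noteq> a" "fst (fst m) = fst l" "snd m = snd l"
    "snd (fst m) = p + weight \<phi> x - (if snd l then 0 else \<phi> (fst l))"
proof -
  have "\<exists>x l u'. u = x @ l # u' \<and> x \<in> words {a} \<and> fst l \<noteq> a \<and> fst (fst m) = fst l \<and> snd m = snd l
    \<and> snd (fst m) = p + weight \<phi> x - (if snd l then 0 else \<phi> (fst l))"
    using assms
  proof (induction u arbitrary: p)
    case (Cons k u)
    show ?case
    proof (cases "fst k = a")
      case True
      then have "unwind \<phi> a (p + weight \<phi> [k]) u = m # v" using Cons.prems by simp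
      from Cons.IH[OF this] obtain x l u' where "u = x @ l # u'" "x \<in> words {a}" "fst l \<noteq> a"
        "fst (fst m) = fst l" "snd m = snd l"
        "snd (fst m) = p + weight \<phi> [k] + weight \<phi> x - (if snd l then 0 else \<phi> (fst l))" by blast
      then show ?thesis
        using True by (intro exI[of _ "k # x"] exI[of _ l] exI[of _ u']) (simp add: algebra_simps)
    next
      case False
      then show ?thesis
        using Cons.prems by (intro exI[of _ "[]"] exI[of _ k] exI[of _ u]) auto
    qed
  qed simp
  then show thesis using that by blast
qed

text \<open>
  Two adjacent letters of the rewritten word cancel only if they come from letters \<open>y\<close> and
  \<open>y\<inverse>\<close> of \<open>u\<close> separated by a power of \<open>a\<close> of weight \<open>0\<close>.
\<close>

lemma reduced_unwind:
  assumes "\<phi> a \<noteq> 0" "reduced u"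
  shows "reduced (unwind \<phi> a p u)"
  using assms(2)
proof (induction u arbitrary: p)
  case (Cons l u)
  have IH: "reduced (unwind \<phi> a q u)" for q
    using Cons by (simp add: reduced_Cons)
  show ?case
  proof (cases "fst l = a")
    case False
    define k where "k = ((fst l, if snd l then p else p - \<phi> (fst l)), snd l)"
    have "hd (unwind \<phi> a (p + weight \<phi> [l]) u) \<noteq> letter_inv k"
      if ne: "unwind \<phi> a (p + weight \<phi> [l]) u \<noteq> []"
    proof
      assume hd: "hd (unwind \<phi> a (p + weight \<phi> [l]) u) = letter_inv k"
      then obtain v where v: "unwind \<phi> a (p + weight \<phi> [l]) u = letter_inv k # v"
        using ne by (metis list.collapse)
      then obtain x m u' where x: "u = x @ m # u'" "x \<in> words {a}" "fst (fst (letter_inv k)) = fst m"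
        "snd (letter_inv k) = snd m"
        "snd (fst (letter_inv k)) = p + weight \<phi> [l] + weight \<phi> x - (if snd m then 0 else \<phi> (fst m))"
        by (rule unwind_Cons)
      then have "weight \<phi> x = 0" "m = letter_inv l"
        by (auto simp: k_def letter_inv_def prod_eq_iff split: if_splits)
      moreover have "reduced x" using Cons.prems x(1) by (simp add: reduced_Cons reduced_append)
      ultimately have "x = []" using weight_run_neq_0[of x a \<phi>] x(2) assms(1) by blast
      then show False using Cons.prems x(1) \<open>m = letter_inv l\<close> by simp
    qed
    then show ?thesis using IH False by (simp add: reduced_Cons k_def)
  qed (use IH in simp)
qed simp

text \<open>The power of \<open>t\<close> between two occurrences of \<open>b\<close> separates their heights.\<close>

lemma unwind_two_heights:
  assumes "reduced (z # u @ [z'])" "fst z = b" "fst z' = b" "u \<in> words {t, b}" "involves u t"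
    "b \<noteq> t" "\<phi> b = 0" "\<phi> t \<noteq> 0"
  shows "unwind \<phi> t p (z # u @ [z']) \<notin> words {(b, i)}"
  using assms(1,2,4,5)
proof (induction u arbitrary: p z)
  case (Cons l u)
  show ?case
  proof (cases "fst l = b")
    case True
    then show ?thesis
      using Cons.IH[of l "p + weight \<phi> [z]"] Cons.prems assms(6,7) by auto
  next
    case False
    define x where "x = takeWhile (\<lambda>l. fst l = t) (l # u @ [z'])"
    define y where "y = dropWhile (\<lambda>l. fst l = t) (l # u @ [z'])"
    have xy: "l # u @ [z'] = x @ y" by (simp add: x_def y_def)
    have "x \<noteq> []" using False Cons.prems by (simp add: x_def)
    have x: "x \<in> words {t}" by (auto simp: x_def words_def dest: set_takeWhileD)
    have "y \<noteq> []" using assms(3,6) by (auto simp: y_def dropWhile_eq_Nil_conv)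
    then obtain m y' where y: "y = m # y'" by (cases y) auto
    have "l # u @ [z'] \<in> words {t, b}" using Cons.prems assms(3) by simp
    then have "fst m \<in> {t, b}" using xy y by simp
    moreover have "fst m \<noteq> t"
      using hd_dropWhile[of "\<lambda>l. fst l = t" "l # u @ [z']"] \<open>y \<noteq> []\<close> y y_def by auto
    ultimately have m: "fst m = b" by simp
    have "reduced (z # x @ y)" using Cons.prems(1) xy by simp
    then have "reduced x" by (simp add: reduced_Cons reduced_append)
    then have "weight \<phi> x \<noteq> 0" using weight_run_neq_0[of x t \<phi>] x \<open>x \<noteq> []\<close> assms(8) by blast
    moreover have "unwind \<phi> t q x = []" for q using x by (simp add: unwind_eq_Nil)
    ultimately show ?thesis
      using xy y m Cons.prems(2) assms(6,7) by (auto simp: unwind_append)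
  qed
qed simp

lemma words_eq_NilI:
  assumes "unwind \<phi> a p u = []" "reduced u" "weight \<phi> u = 0" "\<phi> a \<noteq> 0"
  shows "u = []"
  using assms weight_run_neq_0[of u a \<phi>] unwind_eq_Nil[of \<phi> a p u] by blast

text \<open>A reduced relation \<open>u\<close> rewrites to a reduced word that is trivial in a free
  group, hence empty. So \<open>u\<close> is a power of \<open>a\<close>, and weight 0 leaves only
  the empty word.\<close>

lemma free_mod_unwind:
  fixes \<phi> :: "'a \<Rightarrow> int"
  assumes a: "\<phi> a \<noteq> 0" and w: "weight \<phi> w = 0"
    and V: "\<And>u. u \<in> words U \<Longrightarrow> unwind \<phi> a 0 u \<in> words V"
    and free: "free_mod (range (\<lambda>j. shift j (unwind \<phi> a 0 w))) V"
  shows "free_mod {w} U"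
proof (rule free_modI)
  fix u assume u: "u \<in> words U" "reduced u" "cong {w} u []"
  have "cong {} (unwind \<phi> a 0 u) []"
    using free_modD[OF free V[OF u(1)]] unwind_cong[OF u(3) w, of a 0] by simp
  then have "unwind \<phi> a 0 u = []"
    using cong_empty_reduced[of "unwind \<phi> a 0 u" "[]"] reduced_unwind[where \<phi> = \<phi> and a = a, OF a u(2)] by simp
  moreover have "weight \<phi> u = 0" using weight_cong[OF u(3)] w by simp
  ultimately show "u = []" using words_eq_NilI[of \<phi> a 0 u] u(2) a by blast
qed

section \<open>Magnus' induction\<close>

definition freiheit :: "'a word \<Rightarrow> bool" where
  "freiheit w \<longleftrightarrow> (\<forall>x. involves w x \<longrightarrow> free_mod {w} (- {x}))"

lemma freiheit_relabelD:
  assumes "inj f" "freiheit (relabel f w)"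
  shows "freiheit w"
  unfolding freiheit_def
proof (intro allI impI)
  fix x assume "involves w x"
  then have "free_mod {relabel f w} (- {f x})"
    using assms(2) by (auto simp: freiheit_def involves_relabel)
  then have "free_mod (relabel f ` {w}) (f ` (- {x}))"
    using assms(1) by (auto simp: inj_eq intro: free_mod_subset)
  then show "free_mod {w} (- {x})" using assms(1) free_mod_relabelD by blast
qed

text \<open>Deleting every \<open>t\<close> kills the relator and fixes the words that omit
  \<open>t\<close>: a retraction.\<close>

lemma free_mod_omit_only_letter:
  assumes "w \<in> words {t}"
  shows "free_mod {w} (- {t})"
proof -
  let ?del = "filter (\<lambda>l. fst l \<noteq> t)"
  have w: "?del w = []" using assms by (induction w) auto
  have "cong {w} u v \<Longrightarrow> cong {} (?del u) (?del v)" for u v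
  proof (induction rule: cong.induct)
    case (cong_relator r)
    then show ?case using w by simp
  next
    case (cong_context u v x y)
    then show ?case by (auto intro: cong.cong_context)
  qed (auto intro: cong.intros)
  moreover have "?del u = u" if "u \<in> words (- {t})" for u
    using that by (induction u) auto
  ultimately show ?thesis by (force simp: free_mod_def)
qed

text \<open>
  The words to be proved free avoid all kernel generators \<open>(t, i)\<close>, so they lie in the
  overlap of the pieces of the chain formed by the shifted relators.
\<close>

lemma free_mod_omit_other:
  assumes t: "involves w t" and at: "a \<noteq> t" and a: "\<phi> a \<noteq> 0" and w: "weight \<phi> w = 0"
    and frei: "freiheit (unwind \<phi> a 0 w)"
  shows "free_mod {w} (- {t})"
proof -
  let ?v = "unwind \<phi> a 0 w"
  define I where "I = {i. involves ?v (t, i)}"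
  have "I \<subseteq> (snd \<circ> fst) ` set ?v" by (force simp: I_def involves_iff)
  then have fin: "finite I" by (rule finite_subset) simp
  have ne: "I \<noteq> {}" using involves_unwind[OF t] at by (auto simp: I_def)
  show ?thesis
  proof (rule free_mod_unwind[OF a w])
    show "unwind \<phi> a 0 u \<in> words {(y, i). y \<noteq> t}" if "u \<in> words (- {t})" for u
      using that by (auto simp: words_iff_involves dest: involves_unwindD)
    show "free_mod (range (\<lambda>j. shift j ?v)) {(y, i). y \<noteq> t}"
    proof (rule free_mod_shifts)
      show "involves ?v (t, Min I)" "involves ?v (t, Max I)"
        using Min_in[OF fin ne] Max_in[OF fin ne] by (auto simp: I_def)
      show "Min I \<le> i \<and> i \<le> Max I" if "involves ?v (t, i)" for i
        using that fin by (auto simp: I_def)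
    qed (use frei in \<open>auto simp: freiheit_def\<close>)
  qed
qed

text \<open>Here the rewriting is along the omitted letter itself. Words without \<open>t\<close>
  stay at height 0, so they use only the generators \<open>(y, 0)\<close>; these miss an end of a
  window of \<open>b\<close>-heights as soon as \<open>b\<close> occurs at two heights.\<close>

lemma free_mod_omit_self:
  assumes t: "involves w t" and b: "involves w b" and bt: "b \<noteq> t" and tb: "w \<in> words {t, b}"
    and w: "exponent t w = 0" and red: "reduced (w @ w)"
    and frei: "freiheit (unwind (\<lambda>y. if y = t then 1 else 0) t 0 w)"
  shows "free_mod {w} (- {t})"
proof -
  let ?\<phi> = "\<lambda>y. if y = t then 1 else (0 :: int)"
  let ?v = "unwind ?\<phi> t 0 w"
  define I where "I = {i. involves ?v (b, i)}"
  have "I \<subseteq> (snd \<circ> fst) ` set ?v" by (force simp: I_def involves_iff)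
  then have fin: "finite I" by (rule finite_subset) simp
  have ne: "I \<noteq> {}" using involves_unwind[OF b] bt by (auto simp: I_def)
  have bounds: "Min I \<le> i \<and> i \<le> Max I" if "involves ?v (b, i)" for i
    using that fin by (auto simp: I_def)
  have "Min I \<noteq> Max I"
  proof
    assume eq: "Min I = Max I"
    have "?v \<in> words {(b, Min I)}"
      unfolding words_iff_involves
    proof (intro allI impI)
      fix x assume x: "involves ?v x"
      obtain y i where yi: "x = (y, i)" by force
      then have "y = b" using involves_unwindD x tb by (fastforce simp: words_iff_involves)
      then show "x \<in> {(b, Min I)}" using bounds x yi eq by fastforce
    qed
    then have vv: "unwind ?\<phi> t 0 (w @ w) \<in> words {(b, Min I)}"
      using w by (simp add: unwind_append)
    obtain z where z: "z \<in> set w" "fst z = b" using b by (auto simp: involves_iff)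
    then obtain u u' where u: "w = u @ z # u'" by (metis split_list)
    \<comment> \<open>The square of \<open>w\<close> contains a full period from one
      \<open>z\<close> to the next, so some \<open>t\<close> lies in between even if it does so only
      cyclically.\<close>
    then have ww: "w @ w = u @ (z # (u' @ u) @ [z]) @ u'" by simp
    have "unwind ?\<phi> t (0 + weight ?\<phi> u) (z # (u' @ u) @ [z]) \<in> words {(b, Min I)}"
      using vv unfolding ww unwind_append words_append by blast
    moreover have "unwind ?\<phi> t (0 + weight ?\<phi> u) (z # (u' @ u) @ [z]) \<notin> words {(b, Min I)}"
    proof (rule unwind_two_heights)
      show "reduced (z # (u' @ u) @ [z])"
        using red unfolding ww reduced_append[of u] reduced_append[of "z # (u' @ u) @ [z]"] by blast
      show "involves (u' @ u) t" using t u z bt by auto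
    qed (use z tb u bt in auto)
    ultimately show False by blast
  qed
  then have less: "Min I < Max I" using Min_le[OF fin] Max_in[OF fin ne] by (simp add: less_le)
  show ?thesis
  proof (rule free_mod_unwind[of ?\<phi> t])
    show "unwind ?\<phi> t 0 u \<in> words {(y, i). i = 0}" if "u \<in> words (- {t})" for u
      using that by (induction u) auto
    show "free_mod (range (\<lambda>j. shift j ?v)) {(y, i). i = 0}"
    \<comment> \<open>This shift puts height 0 at the top of the window; the bottom,
      \<open>Min I - Max I\<close>, is then negative and is missed.\<close>
    proof (rule free_mod_shifts[where ?j0.0 = "- Max I"])
      show "involves ?v (b, Min I)" "involves ?v (b, Max I)"
        using Min_in[OF fin ne] Max_in[OF fin ne] by (auto simp: I_def)
    qed (use frei bounds less in \<open>auto simp: freiheit_def\<close>)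
  qed (use w in auto)
qed

theorem Freiheitssatz:
  fixes w :: "'a :: countable word"
  assumes "reduced (w @ w)" "involves w t"
  shows "free_mod {w} (- {t})"
proof -
  \<comment> \<open>Rewriting changes the type of letters to pairs with an integer, while the
    induction stays at one type. Coding the pairs by \<open>to_nat\<close> returns to
    \<open>nat\<close>.\<close>
  have nat: "reduced (w @ w) \<Longrightarrow> freiheit w" for w :: "nat word"
  proof (induction w rule: length_induct)
    case (1 w)
    have IH: "freiheit (unwind \<phi> a 0 w)" if "involves w a" "\<phi> a \<noteq> 0" "weight \<phi> w = 0" for \<phi> a
    proof -
      let ?v = "unwind \<phi> a 0 w" and ?f = "to_nat :: nat \<times> int \<Rightarrow> nat"
      \<comment> \<open>Cyclic reducedness is inherited: as \<open>w\<close> has weight 0, the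
        square of \<open>w\<close> rewrites to the square of its rewriting.\<close>
      have "reduced (unwind \<phi> a 0 (w @ w))" 
        using reduced_unwind[where \<phi> = \<phi> and a = a] that(2) 1(2) by blast
      then have "reduced (relabel ?f (?v @ ?v))"
        using that(3) reduced_relabel[OF inj_to_nat, of "?v @ ?v"] by (simp add: unwind_append)
      then have "freiheit (relabel ?f ?v)"
        using 1(1) length_unwind_less[OF that(1)] by simp
      then show ?thesis using freiheit_relabelD[OF inj_to_nat] by blast
    qed
    show ?case
      unfolding freiheit_def
    proof (intro allI impI)
      fix t assume t: "involves w t"
      \<comment> \<open>If the first two cases fail, \<open>t\<close> has exponent sum 0 and every
        other letter a nonzero one. Two such letters balance each other in a weight that ignores
        \<open>t\<close>; a single one leaves only the rewriting along \<open>t\<close>.\<close>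
      consider "w \<in> words {t}"
        | a where "involves w a" "a \<noteq> t" "exponent a w = 0 \<or> exponent t w \<noteq> 0"
        | b c where "involves w b" "b \<noteq> t" "involves w c" "c \<noteq> t" "b \<noteq> c" "exponent c w \<noteq> 0"
        | b where "involves w b" "b \<noteq> t" "w \<in> words {t, b}" "exponent t w = 0"
        unfolding words_iff_involves by blast
      then show "free_mod {w} (- {t})"
      proof cases
        case 1
        then show ?thesis by (rule free_mod_omit_only_letter)
      next
        case (2 a)
        show ?thesis
        proof (cases "exponent t w = 0")
          case True
          then show ?thesis
            using 2 t IH[of a "\<lambda>y. if y = a then 1 else 0"]
            by (intro free_mod_omit_other[of w t a "\<lambda>y. if y = a then 1 else 0"]) auto
        next
          case False
          let ?\<phi> = "\<lambda>y. if y = a then exponent t w else if y = t then - exponent a w else 0"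
          have "weight ?\<phi> w = 0" using weight_two[OF 2(2)] by simp
          then show ?thesis
            using 2 t False IH[of a ?\<phi>] by (intro free_mod_omit_other[of w t a ?\<phi>]) auto
        qed
      next
        case (3 b c)
        let ?\<phi> = "\<lambda>y. if y = b then exponent c w else if y = c then - exponent b w else 0"
        have "weight ?\<phi> w = 0" using weight_two[OF 3(5)] by simp
        then show ?thesis
          using 3 t IH[of b ?\<phi>] by (intro free_mod_omit_other[of w t b ?\<phi>]) auto
      next
        case (4 b)
        then show ?thesis
          using t \<open>reduced (w @ w)\<close> IH[of t "\<lambda>y. if y = t then 1 else 0"]
          by (intro free_mod_omit_self[of w t b]) auto
      qed
    qed
  qed
  have "freiheit (relabel to_nat w)"
    using assms(1) reduced_relabel[OF inj_to_nat, of "w @ w"] by (intro nat) simp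
  then have "freiheit w" using freiheit_relabelD[OF inj_to_nat] by blast
  then show ?thesis using assms(2) by (simp add: freiheit_def)
qed

section \<open>Presented groups\<close>

lemma words_carrier: "u \<in> carrier (free_group X) \<longleftrightarrow> reduced u \<and> u \<in> words X"
  by (auto simp: free_group_def words_def)

lemma mult_free_group: "u \<otimes>\<^bsub>free_group X\<^esub> v = free_reduce (u @ v)"
  by (simp add: free_group_def)

lemma one_free_group: "\<one>\<^bsub>free_group X\<^esub> = []"
  by (simp add: free_group_def)

lemma inv_free_group:
  assumes "u \<in> carrier (free_group X)"
  shows "inv\<^bsub>free_group X\<^esub> u = free_reduce (winv u)"
proof (rule group.inv_equality[OF group_free_group])
  show "free_reduce (winv u) \<otimes>\<^bsub>free_group X\<^esub> u = \<one>\<^bsub>free_group X\<^esub>"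
    by (simp add: mult_free_group one_free_group free_reduce_append_left winv_def free_reduce_inverse)
qed (use assms in \<open>auto simp: words_carrier reduced_free_reduce intro: words_free_reduce\<close>)

lemma cong_free_reduce_iff [simp]:
  "cong R (free_reduce u) v \<longleftrightarrow> cong R u v" "cong R v (free_reduce u) \<longleftrightarrow> cong R v u"
  using cong_free_reduce[of R u] by (meson cong_sym cong_trans)+

locale presentation =
  fixes X :: "'a set" and R :: "'a word set"
  assumes relators: "R \<subseteq> carrier (free_group X)"
begin

abbreviation F where "F \<equiv> free_group X"
abbreviation N where "N \<equiv> normal_closure F R"
abbreviation G where "G \<equiv> presented_group X R"

sublocale F: group F
  by (rule group_free_group)

sublocale N: normal N F
  by (intro normal_normal_closure group_free_group relators)

sublocale G: group G
  by (rule group_presented_group[OF relators])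

text \<open>The reduced words over \<open>X\<close> congruent to \<open>[]\<close> form a normal
  subgroup containing the relators, hence contain the normal closure.\<close>

lemma closure_cong: "u \<in> N \<Longrightarrow> cong R u []"
proof -
  let ?K = "{u \<in> carrier F. cong R u []}"
  have "?K \<lhd> F"
  proof (rule F.normal_invI)
    show "subgroup ?K F"
    proof (rule F.subgroupI)
      show "?K \<noteq> {}" using F.one_closed by (auto simp: one_free_group)
      show "inv\<^bsub>F\<^esub> u \<in> ?K" if "u \<in> ?K" for u
        using that cong_winv[of R u "[]"] F.inv_closed[of u] by (auto simp: inv_free_group)
      show "u \<otimes>\<^bsub>F\<^esub> v \<in> ?K" if "u \<in> ?K" "v \<in> ?K" for u v
        using that cong_append[of R u "[]" v "[]"] F.m_closed[of u v] by (auto simp: mult_free_group)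
    qed auto
    show "x \<otimes>\<^bsub>F\<^esub> h \<otimes>\<^bsub>F\<^esub> inv\<^bsub>F\<^esub> x \<in> ?K" if "x \<in> carrier F" "h \<in> ?K" for x h
    proof -
      have "cong R (x @ h @ winv x) (x @ [] @ winv x)"
        using that by (intro cong_context) auto
      then have "cong R (x @ h @ winv x) []"
        using cong_winv_right[of R x] by (auto intro: cong_trans)
      then have "cong R (x \<otimes>\<^bsub>F\<^esub> h \<otimes>\<^bsub>F\<^esub> inv\<^bsub>F\<^esub> x) []"
        using that
        by (simp add: mult_free_group inv_free_group free_reduce_append_left free_reduce_append_right)
      then show ?thesis using that by auto
    qed
  qed
  moreover have "R \<subseteq> ?K" using relators by (auto intro: cong_relator)
  ultimately have "N \<subseteq> ?K" by (auto simp: normal_closure_def)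
  then show "u \<in> N \<Longrightarrow> cong R u []" by blast
qed

text \<open>Letters outside \<open>X\<close> are killed, so that \<open>cls\<close> is multiplicative on all words.\<close>

definition cls :: "'a word \<Rightarrow> 'a word set" where
  "cls u = N #>\<^bsub>F\<^esub> free_reduce (filter (\<lambda>l. fst l \<in> X) u)"

lemma filter_carrier: "free_reduce (filter (\<lambda>l. fst l \<in> X) u) \<in> carrier F"
  by (auto simp: words_carrier reduced_free_reduce intro!: words_free_reduce) (auto simp: words_def)

lemma filter_words: "u \<in> words X \<Longrightarrow> filter (\<lambda>l. fst l \<in> X) u = u"
  by (induction u) auto

lemma cls_carrier: "u \<in> carrier F \<Longrightarrow> cls u = N #>\<^bsub>F\<^esub> u"
  by (simp add: cls_def filter_words words_carrier free_reduce_id)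

lemma cls_closed: "cls u \<in> carrier G"
  using filter_carrier[of u] by (auto simp: cls_def presented_group_def carrier_FactGroup)

lemma carrier_cls: "S \<in> carrier G \<Longrightarrow> \<exists>u\<in>carrier F. S = cls u"
  using cls_carrier by (auto simp: presented_group_def carrier_FactGroup)

lemma cls_append: "cls (u @ v) = cls u \<otimes>\<^bsub>G\<^esub> cls v"
  using N.rcos_sum[OF filter_carrier filter_carrier, of u v]
  by (simp add: cls_def presented_group_def mult_free_group free_reduce_append_left
      free_reduce_append_right)

lemma cls_Nil: "cls [] = \<one>\<^bsub>G\<^esub>"
  using cls_append[of "[]" "[]"] cls_closed[of "[]"] by simp

lemma cls_cong: "cong R u v \<Longrightarrow> cls u = cls v"
proof (induction rule: cong.induct)
  case (cong_context u v x y)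
  then show ?case by (simp add: cls_append)
next
  case (cong_cancel l)
  have "free_reduce [l, letter_inv l] = []" by (simp add: free_reduce_def)
  then show ?case by (simp add: cls_def free_reduce_def)
next
  case (cong_relator r)
  then have "r \<in> N" "r \<in> carrier F" using relators by (auto simp: normal_closure_def)
  then have "cls r = N" using F.coset_join2[OF _ N.subgroup_axioms] cls_carrier by simp
  then show ?case by (simp add: cls_Nil presented_group_def)
qed auto

lemma cls_mem_cong:
  assumes "u \<in> carrier F" "v \<in> cls u"
  shows "v \<in> carrier F" "cong R v u"
proof -
  obtain m where m: "m \<in> N" "v = m \<otimes>\<^bsub>F\<^esub> u"
    using assms cls_carrier by (auto simp: r_coset_def)
  then show "v \<in> carrier F" using assms N.subset by auto
  show "cong R v u"
    using m cong_append[OF closure_cong[OF m(1)] cong_refl[of R u]] by (simp add: mult_free_group)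
qed

lemma mem_cls: "u \<in> carrier F \<Longrightarrow> u \<in> cls u"
  using F.rcos_self[OF _ N.subgroup_axioms] cls_carrier by simp

lemma cls_eq_iff:
  assumes "u \<in> words X" "v \<in> words X"
  shows "cls u = cls v \<longleftrightarrow> cong R u v"
proof
  have c: "free_reduce u \<in> carrier F" "free_reduce v \<in> carrier F"
    using assms by (auto simp: words_carrier reduced_free_reduce intro: words_free_reduce)
  assume "cls u = cls v"
  then have "cls (free_reduce u) = cls (free_reduce v)"
    using cls_cong[of "free_reduce u" u] cls_cong[of "free_reduce v" v] by simp
  then have "cong R (free_reduce u) (free_reduce v)"
    using mem_cls[OF c(1)] cls_mem_cong(2)[OF c(2), of "free_reduce u"] by simp
  then show "cong R u v" by simp
qed (rule cls_cong)

lemma cls_gen: "x \<in> X \<Longrightarrow> cls [(x, True)] = presented_gen X R x"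
  using cls_carrier[of "[(x, True)]"] by (simp add: presented_gen_def words_carrier)

text \<open>Serves the intersection hypothesis: an element with a representative over each block
  lies in each of the generated subgroups.\<close>

lemma cls_generate:
  assumes "S \<subseteq> X" "u \<in> words S"
  shows "cls u \<in> generate G (presented_gen X R ` S)"
  using assms(2)
proof (induction u)
  case Nil
  then show ?case by (simp add: cls_Nil generate.one)
next
  case (Cons l u)
  have x: "fst l \<in> X" "cls [(fst l, True)] = presented_gen X R (fst l)"
    using Cons.prems assms(1) cls_gen by auto
  have "cls [l] \<in> generate G (presented_gen X R ` S)"
  proof (cases "snd l")
    case True
    then have "[l] = [(fst l, True)]" by (simp add: prod_eq_iff)
    then have "cls [l] = presented_gen X R (fst l)" using x by metis
    then show ?thesis using Cons.prems by (simp add: generate.incl)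
  next
    case False
    have "cong R [l, (fst l, True)] []"
      using cong_cancel[of R l] False by (simp add: letter_inv_def)
    then have "cls [l] \<otimes>\<^bsub>G\<^esub> cls [(fst l, True)] = \<one>\<^bsub>G\<^esub>"
      using cls_append[of "[l]" "[(fst l, True)]"] cls_cong cls_Nil by simp
    then have "cls [l] = inv\<^bsub>G\<^esub> presented_gen X R (fst l)"
      using G.inv_equality[OF _ cls_closed cls_closed] x(2) by metis
    then show ?thesis using Cons.prems by (simp add: generate.inv)
  qed
  then show ?case
    using Cons cls_append[of "[l]" u] by (auto intro: generate.eng)
qed

end

lemma presentation_embedding:
  assumes "presentation X R" "presentation X' R'" "X \<subseteq> X'" "R \<subseteq> R'"
    and inj: "\<And>u. u \<in> words X \<Longrightarrow> cong R' u [] \<Longrightarrow> cong R u []"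
  shows "\<exists>\<phi>\<in>mon (presented_group X R) (presented_group X' R').
    \<forall>x\<in>X. \<phi> (presented_gen X R x) = presented_gen X' R' x"
proof -
  interpret P: presentation X R by fact
  interpret P': presentation X' R' by fact
  \<comment> \<open>All words of a coset have the same class in the larger group, so the union is
    this single class and no representative is chosen.\<close>
  define \<phi> where "\<phi> S = (\<Union>u\<in>S. P'.cls u)" for S
  have \<phi>: "\<phi> (P.cls u) = P'.cls u" if u: "u \<in> carrier P.F" for u
  proof -
    have "P'.cls v = P'.cls u" if "v \<in> P.cls u" for v
      using P'.cls_cong[OF cong_mono[OF P.cls_mem_cong(2)[OF u that] assms(4)]] .
    then have "(\<Union>v\<in>P.cls u. P'.cls v) = (\<Union>v\<in>P.cls u. P'.cls u)"
      by (rule SUP_cong[OF refl])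
    then show ?thesis using P.mem_cls[OF u] unfolding \<phi>_def by blast
  qed
  have "\<phi> \<in> hom (presented_group X R) (presented_group X' R')"
  proof (rule homI)
    fix S assume "S \<in> carrier (presented_group X R)"
    then show "\<phi> S \<in> carrier (presented_group X' R')"
      using P.carrier_cls \<phi> P'.cls_closed by fastforce
  next
    fix S T assume "S \<in> carrier (presented_group X R)" "T \<in> carrier (presented_group X R)"
    then obtain u v where u: "u \<in> carrier P.F" "S = P.cls u" and v: "v \<in> carrier P.F" "T = P.cls v"
      using P.carrier_cls by metis
    have uv: "u \<otimes>\<^bsub>P.F\<^esub> v \<in> carrier P.F" using u v by simp
    have "P.cls (u \<otimes>\<^bsub>P.F\<^esub> v) = S \<otimes>\<^bsub>presented_group X R\<^esub> T"
      using u v P.cls_cong[of "u \<otimes>\<^bsub>P.F\<^esub> v" "u @ v"] by (simp add: P.cls_append mult_free_group)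
    moreover have "P'.cls (u \<otimes>\<^bsub>P.F\<^esub> v) = \<phi> S \<otimes>\<^bsub>presented_group X' R'\<^esub> \<phi> T"
      using u v \<phi> P'.cls_cong[of "u \<otimes>\<^bsub>P.F\<^esub> v" "u @ v"] by (simp add: P'.cls_append mult_free_group)
    ultimately show "\<phi> (S \<otimes>\<^bsub>presented_group X R\<^esub> T) = \<phi> S \<otimes>\<^bsub>presented_group X' R'\<^esub> \<phi> T"
      using \<phi>[OF uv] by simp
  qed
  moreover have "inj_on \<phi> (carrier (presented_group X R))"
  proof (rule inj_onI)
    fix S T assume "S \<in> carrier (presented_group X R)" "T \<in> carrier (presented_group X R)" and eq: "\<phi> S = \<phi> T"
    then obtain u v where u: "u \<in> carrier P.F" "S = P.cls u" and v: "v \<in> carrier P.F" "T = P.cls v"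
      using P.carrier_cls by metis
    have w: "u \<in> words X" "v \<in> words X" using u(1) v(1) by (simp_all add: words_carrier)
    have "P'.cls u = P'.cls v"
      using eq \<phi>[OF u(1)] \<phi>[OF v(1)] unfolding u(2) v(2) by argo
    then have "cong R' u v"
      using P'.cls_eq_iff words_mono[OF w(1) assms(3)] words_mono[OF w(2) assms(3)] by blast
    then have "cong R u v"
      using inj[of "u @ winv v"] w by (simp add: cong_iff_winv[of _ u])
    then show "S = T" using u v P.cls_cong by simp
  qed
  moreover have "\<phi> (presented_gen X R x) = presented_gen X' R' x" if "x \<in> X" for x
    using that \<phi>[of "[(x, True)]"] P.cls_gen P'.cls_gen assms(3) by (auto simp: words_carrier)
  ultimately show ?thesis by (auto simp: mon_def)
qed

section \<open>Arcs of the cycle\<close>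

lemma free_mod_cong_iff:
  assumes "free_mod R X" "u \<in> words X" "v \<in> words X"
  shows "cong R u v \<longleftrightarrow> cong {} u v"
  using free_mod_iff[OF assms(1), of "u @ winv v"] assms by (simp add: cong_iff_winv[of _ u])

locale staggered =
  fixes k :: nat and w :: "nat word"
  assumes k: "k \<ge> 1" and w: "w \<in> words {0..k}" and red: "reduced (w @ w)"
    and inv_0: "involves w 0" and inv_k: "involves w k"
begin

text \<open>The relators are unrolled along the natural numbers; subscripts are reduced mod n only
  when the cycle is closed.\<close>

definition r :: "nat \<Rightarrow> nat word" where
  "r i = relabel (\<lambda>j. j + i) w"

definition H :: "nat \<Rightarrow> nat \<Rightarrow> nat word set" where
  "H p q = r ` {p..q}"

lemma r_words: "r i \<in> words {i..i + k}"
  using words_relabel[OF w, of "\<lambda>j. j + i"] by (simp add: r_def add.commute)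

lemma free_relator: "i \<notin> U \<or> i + k \<notin> U \<Longrightarrow> free_mod {r i} U"
proof -
  have "reduced (r i @ r i)"
    using red reduced_relabel[of "\<lambda>j. j + i" "w @ w"] by (simp add: r_def inj_def)
  moreover have "involves (r i) i" "involves (r i) (i + k)"
    using inv_0 inv_k by (auto simp: r_def involves_relabel)
  ultimately have "free_mod {r i} (- {i})" "free_mod {r i} (- {i + k})"
    using Freiheitssatz by blast+
  then show "i \<notin> U \<or> i + k \<notin> U \<Longrightarrow> free_mod {r i} U"
    by (auto elim: free_mod_subset)
qed

sublocale chain "\<lambda>i. {i..i + k}" r
  by unfold_locales (auto intro: r_words free_relator)

lemma letters_eq: "p \<le> q \<Longrightarrow> letters p q = {p..q + k}"
proof
  assume "p \<le> q"
  show "{p..q + k} \<subseteq> letters p q"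
  proof
    fix x assume "x \<in> {p..q + k}"
    then show "x \<in> letters p q"
      using \<open>p \<le> q\<close> by (auto simp: letters_def intro!: bexI[of _ "min x q"])
  qed
qed (auto simp: letters_def)

lemma H_words: "p \<le> q \<Longrightarrow> H p q \<subseteq> words {p..q + k}"
  using relators_words[of p q] letters_eq[of p q] by (simp add: H_def)

lemma split_H: "p \<le> q \<Longrightarrow> q < s \<Longrightarrow> free_amalgam {p..q + k} {Suc q..s + k} (H p q) (H (Suc q) s)"
  using split[of p q s] by (simp add: H_def letters_eq)

lemma H_Un: "p \<le> q \<Longrightarrow> q < s \<Longrightarrow> H p q \<union> H (Suc q) s = H p s"
  by (auto simp: H_def image_iff) (metis atLeastAtMost_iff not_less_eq_eq)

lemma H_mono: "p \<le> p' \<Longrightarrow> q' \<le> q \<Longrightarrow> H p' q' \<subseteq> H p q"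
  by (auto simp: H_def)

lemma embed_H:
  assumes "p \<le> p'" "p' \<le> q'" "q' \<le> q" "u \<in> words {p'..q' + k}" "v \<in> words {p'..q' + k}" "cong (H p q) u v"
  shows "cong (H p' q') u v"
proof -
  have 1: "cong (H p q') u v"
  proof (cases "q' = q")
    case False
    then have q: "p \<le> q'" "q' < q" using assms by auto
    have "{p'..q' + k} \<subseteq> {p..q' + k}" using assms by auto
    then show ?thesis
      using free_amalgam.embed_left[OF split_H[OF q], of u v] assms H_Un[OF q] words_mono by metis
  qed (use assms in simp)
  show ?thesis
  proof (cases "p = p'")
    case False
    then have p: "p \<le> p' - 1" "p' - 1 < q'" using assms by auto
    have "Suc (p' - 1) = p'" using False assms by simp
    then show ?thesis
      using free_amalgam.embed_right[OF split_H[OF p], of u v] assms H_Un[OF p] 1 by simp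
  qed (use 1 in simp)
qed

text \<open>The block at \<open>i\<close> consists of the first k letters of relator
  \<open>i\<close> and misses \<open>i + k\<close>. Past the last relator, at
  \<open>i = Suc q\<close>, it consists of the last k letters of relator \<open>q\<close> and misses
  \<open>q\<close>.\<close>

lemma free_F:
  assumes "p \<le> q" "p \<le> i" "i \<le> Suc q"
  shows "free_mod (H p q) {i..<i + k}"
proof (cases "i = Suc q")
  case True
  then show ?thesis
    unfolding H_def using assms
    by (intro free_piece[of p q] free_relator) auto
next
  case False
  then show ?thesis
    unfolding H_def using assms by (intro free_piece[of p i] free_relator) auto
qed

lemma translate_H:
  assumes "p \<le> q" "u \<in> words {p..q + k}" "v \<in> words {p..q + k}"
  shows "cong (H (p + i) (q + i)) (relabel (\<lambda>j. j + i) u) (relabel (\<lambda>j. j + i) v) \<longleftrightarrow> cong (H p q) u v"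
proof -
  have "relabel (\<lambda>j. j + i) ` H p q = (\<lambda>m. r (m + i)) ` {p..q}"
    by (auto simp: H_def r_def relabel_relabel image_image add.assoc)
  also have "\<dots> = r ` ((\<lambda>m. m + i) ` {p..q})" by (rule image_image[symmetric])
  also have "\<dots> = H (p + i) (q + i)" unfolding H_def by (simp only: image_add_atLeastAtMost')
  finally show ?thesis
    using cong_relabel_iff[of "\<lambda>j. j + i", OF _ H_words[OF assms(1)] assms(2,3)]
    by (simp add: inj_on_def)
qed

text \<open>Cut the arc just before relator \<open>j\<close>: \<open>u\<close> lies over the left
  part, \<open>v\<close> over the right part, and the two parts share exactly the block at
  \<open>j\<close>.\<close>

lemma cong_between:
  assumes "u \<in> words {p..<p + k}" "v \<in> words {m..<m + k}" "p \<le> m" "m \<le> Suc q"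
    and "cong (H p q) u v" and "p \<le> j" "j \<le> m"
  shows "\<exists>y\<in>words {j..<j + k}. cong (H p q) u y"
proof -
  consider "j = p" | "j = m" | "p < j" "j < m" using assms by force
  then show ?thesis
  proof cases
    case 3
    then have q: "p \<le> j - 1" "j - 1 < q" "Suc (j - 1) = j" using assms by auto
    have "{p..<p + k} \<subseteq> {p..j - 1 + k}" "{m..<m + k} \<subseteq> {j..q + k}"
      using 3 assms by auto
    then have "u \<in> words {p..j - 1 + k}" "v \<in> words {Suc (j - 1)..q + k}"
      using assms(1,2) words_mono q(3) by metis+
    then obtain y where y: "y \<in> words ({p..j - 1 + k} \<inter> {Suc (j - 1)..q + k})" "cong (H p (j - 1)) u y"
      using free_amalgam.inter_cong[OF split_H[OF q(1,2)], of u v] assms(5) H_Un[OF q(1,2)] by metis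
    have "{p..j - 1 + k} \<inter> {Suc (j - 1)..q + k} \<subseteq> {j..<j + k}" using q(3) 3 by auto
    then have "y \<in> words {j..<j + k}" using y(1) words_mono by blast
    moreover have "cong (H p q) u y"
      using y(2) cong_mono H_mono[of p p "j - 1" q] q by simp
    ultimately show ?thesis by blast
  qed (use assms in auto)
qed

end

text \<open>The hypothesis in terms of words: an element of the intersection has a representative
  over each block, and \<open>u\<close> is the one over the first.\<close>

locale trivial_intersection = staggered +
  assumes trivial: "\<And>u. u \<in> words {0..<k} \<Longrightarrow>
    (\<And>j. j \<le> k \<Longrightarrow> \<exists>v\<in>words {j..<j + k}. cong (H 0 (2 * k - 1)) u v) \<Longrightarrow> cong (H 0 (2 * k - 1)) u []"
begin

text \<open>The blocks \<open>p\<close> to \<open>p + k\<close> lie over the k relators from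
  \<open>p\<close> on, and this shorter arc embeds in the given one. Relations therefore descend to
  it, translate to 0, and rise to the 2k relators of the hypothesis.\<close>

lemma trivial_translate:
  assumes u: "u \<in> words {p..<p + k}" and q: "p + k \<le> Suc q"
    and v: "\<And>j. j \<le> k \<Longrightarrow> \<exists>v\<in>words {p + j..<p + j + k}. cong (H p q) u v"
  shows "cong {} u []"
proof -
  have im: "(\<lambda>x. x + p) ` {j..<j + k} = {p + j..<p + j + k}" for j
    by (simp add: ac_simps)
  have "u \<in> words ((\<lambda>x. x + p) ` {0..<k})" using u by (simp add: add.commute)
  then obtain u' where u': "u' \<in> words {0..<k}" "u = relabel (\<lambda>x. x + p) u'"
    by (rule words_relabelE)
  have "cong (H 0 (2 * k - 1)) u' []"
  proof (rule trivial[OF u'(1)])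
    fix j assume j: "j \<le> k"
    with v obtain v where v: "v \<in> words {p + j..<p + j + k}" "cong (H p q) u v" by blast
    have "v \<in> words ((\<lambda>x. x + p) ` {j..<j + k})" using v(1) unfolding im .
    then obtain v' where v': "v' \<in> words {j..<j + k}" "v = relabel (\<lambda>x. x + p) v'"
      by (rule words_relabelE)
    have "u \<in> words {p..p + k - 1 + k}" using u by (rule words_mono) auto
    moreover have "v \<in> words {p..p + k - 1 + k}" using v(1) by (rule words_mono) (use j in auto)
    moreover have e: "0 + p = p" "k - 1 + p = p + k - 1" using k by simp_all
    ultimately have "cong (H p (p + k - 1)) u v"
      using q k v(2) embed_H[of p p "p + k - 1" q u v] by simp
    then have "cong (H (0 + p) (k - 1 + p)) (relabel (\<lambda>x. x + p) u') (relabel (\<lambda>x. x + p) v')"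
      unfolding e u'(2) v'(2) .
    moreover have "u' \<in> words {0..k - 1 + k}" using u'(1) by (rule words_mono) auto
    moreover have "v' \<in> words {0..k - 1 + k}" using v'(1) by (rule words_mono) (use j in auto)
    ultimately have "cong (H 0 (k - 1)) u' v'" using translate_H[of 0 "k - 1" u' v' p] by blast
    then have "cong (H 0 (2 * k - 1)) u' v'"
      by (rule cong_mono) (rule H_mono, auto)
    with v' show "\<exists>v\<in>words {j..<j + k}. cong (H 0 (2 * k - 1)) u' v" by blast
  qed
  then have "cong {} u' []"
    using free_modD[OF free_F[of 0 "2 * k - 1" 0]] u' by simp
  then show ?thesis using cong_relabel[of "{}" u' "[]" "\<lambda>x. x + p"] u' by simp
qed

lemma free_ends:
  assumes "p + 2 * k \<le> Suc q"
  shows "free_mod (H p q) ({p..<p + k} \<union> {Suc q..<Suc q + k})"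
proof -
  \<comment> \<open>The cut after relator \<open>p + k - 1\<close> leaves exactly k relators on the
    left and at least k on the right, as \<open>trivial_translate\<close> demands on each
    side.\<close>
  have s: "p \<le> p + k - 1" "p + k - 1 < q" "Suc (p + k - 1) = p + k" using assms k by auto
  have int: "{p..p + k - 1 + k} \<inter> {p + k..q + k} = {p + k..<p + k + k}"
    using assms k by auto
  interpret free_amalgam "{p..p + k - 1 + k}" "{p + k..q + k}" "H p (p + k - 1)" "H (p + k) q"
    using split_H[OF s(1,2)] s(3) by simp
  have "free_mod (H p (p + k - 1) \<union> H (p + k) q) ({p..<p + k} \<union> {Suc q..<Suc q + k})"
  proof (rule free_product_free, unfold int)
    fix u y assume u: "u \<in> words {p..<p + k}" "y \<in> words {p + k..<p + k + k}"
      and c: "cong (H p (p + k - 1)) u y"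
    show "cong {} u []"
    proof (rule trivial_translate[OF u(1)])
      show "\<exists>v\<in>words {p + j..<p + j + k}. cong (H p (p + k - 1)) u v" if "j \<le> k" for j
        using cong_between[OF u _ _ c, of "p + j"] that k by simp
    qed (use k in simp)
  next
    fix u y assume u: "u \<in> words {Suc q..<Suc q + k}" "y \<in> words {p + k..<p + k + k}"
      and c: "cong (H (p + k) q) u y"
    \<comment> \<open>On the right the lowest block contains \<open>y\<close> rather than
      \<open>u\<close>, so triviality is shown for \<open>y\<close> and carried over to
      \<open>u\<close>.\<close>
    have "cong {} y []"
    proof (rule trivial_translate[OF u(2)])
      show "\<exists>v\<in>words {p + k + j..<p + k + j + k}. cong (H (p + k) q) y v" if "j \<le> k" for j
        using cong_between[OF u(2,1) _ _ cong_sym[OF c], of "p + k + j"] that assms by simp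
    qed (use assms in simp)
    then have "cong (H (p + k) q) u []"
      using c cong_mono[of "{}" y "[]" "H (p + k) q"] by (auto intro: cong_trans)
    moreover have "p + k \<le> q" using s by simp
    ultimately show "cong {} u []"
      using free_modD[OF free_F[of "p + k" q "Suc q"] u(1)] by simp
  qed (use assms k in auto)
  then show ?thesis using H_Un[OF s(1,2)] s(3) by simp
qed

end

section \<open>Closing the cycle\<close>

definition cyc :: "nat \<Rightarrow> nat \<Rightarrow> nat word \<Rightarrow> nat word" where
  "cyc n i = relabel (\<lambda>x. (x + i) mod n)"

lemma theta_power:
  assumes "u \<in> words {0..<n}"
  shows "(theta n ^^ i) u = cyc n i u"
proof (induction i)
  case 0
  then show ?case using relabel_id[OF assms, of "\<lambda>x. x mod n"] by (simp add: cyc_def)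
next
  case (Suc i)
  then show ?case by (simp add: theta_def cyc_def relabel_relabel mod_Suc_eq)
qed

context trivial_intersection
begin

context
  fixes n :: nat
  assumes n: "n \<ge> 4 * k"
begin

definition C :: "nat word set" where
  "C = {cyc n i w | i. i < n}"

lemma C_eq: "C = H 0 (2 * k - 1) \<union> relabel (\<lambda>x. x mod n) ` H (2 * k) (n - 1)"
proof -
  have 1: "cyc n i w = relabel (\<lambda>x. x mod n) (r i)" for i
    by (simp add: cyc_def r_def relabel_relabel)
  \<comment> \<open>These relators end at the letter \<open>3 * k - 1\<close> at the latest, which
    is below n, so they do not wrap around.\<close>
  have "cyc n i w = r i" if "i \<le> 2 * k - 1" for i
    unfolding 1
  proof (rule relabel_id[OF r_words])
    fix x assume "x \<in> {i..i + k}"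
    then have "x < n" using that n k by auto
    then show "x mod n = x" by simp
  qed
  then have "H 0 (2 * k - 1) = (\<lambda>i. cyc n i w) ` {0..2 * k - 1}"
    by (simp add: H_def)
  moreover have "relabel (\<lambda>x. x mod n) ` H (2 * k) (n - 1) = (\<lambda>i. cyc n i w) ` {2 * k..n - 1}"
    by (simp add: H_def 1 image_image)
  moreover have "C = (\<lambda>i. cyc n i w) ` ({0..2 * k - 1} \<union> {2 * k..n - 1})"
    using n k by (force simp: C_def)
  ultimately show ?thesis by (simp add: image_Un)
qed

text \<open>
  The relators \<open>2k, \<dots>, n-1\<close> form a second, longer arc of the cycle; it meets the arc of
  \<open>H\<^sub>1\<close> in the two blocks \<open>x\<^sub>0, \<dots>, x\<^sub>k\<^sub>-\<^sub>1\<close> and \<open>x\<^sub>2\<^sub>k, \<dots>, x\<^sub>3\<^sub>k\<^sub>-\<^sub>1\<close>, which are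
  free generators of a free subgroup on both sides.
\<close>

lemma arcs:
  "free_amalgam {0..<3 * k} ((\<lambda>x. x mod n) ` {2 * k..<n + k})
    (H 0 (2 * k - 1)) (relabel (\<lambda>x. x mod n) ` H (2 * k) (n - 1))"
proof -
  have ivl: "{0..2 * k - 1 + k} = {0..<3 * k}" "{2 * k..n - 1 + k} = {2 * k..<n + k}"
    using n k by auto
  \<comment> \<open>An interval of \<open>n - k\<close> consecutive numbers has distinct residues,
    so the second arc wraps around without touching itself.\<close>
  have inj: "inj_on (\<lambda>x. x mod n) {2 * k..<n + k}"
  proof (rule inj_onI)
    fix x y assume xy: "x \<in> {2 * k..<n + k}" "y \<in> {2 * k..<n + k}" "x mod n = y mod n"
    show "x = y"
      using xy k n by (cases "x < n"; cases "y < n") (auto simp: le_mod_geq)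
  qed
  have "{2 * k..<n + k} = {2 * k..<n} \<union> {n..<n + k}" using n k by auto
  moreover have "(\<lambda>x. x mod n) ` {n..<n + k} = {0..<k}"
  proof -
    have "(\<lambda>x. x mod n) ` {n..<n + k} = (\<lambda>x. x mod n) ` ((\<lambda>x. x + n) ` {0..<k})"
      by (simp add: add.commute)
    also have "\<dots> = (\<lambda>x. x) ` {0..<k}"
      unfolding image_image using n by (intro image_cong) auto
    finally show ?thesis by simp
  qed
  moreover have mid: "(\<lambda>x. x mod n) ` A = A" if "A \<subseteq> {..<n}" for A
    using that by (force simp: image_iff)
  moreover have "(\<lambda>x. x mod n) ` {2 * k..<n} = {2 * k..<n}" by (rule mid) auto
  ultimately have im: "(\<lambda>x. x mod n) ` {2 * k..<n + k} = {2 * k..<n} \<union> {0..<k}"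
    and im': "(\<lambda>x. x mod n) ` ({2 * k..<2 * k + k} \<union> {n..<n + k}) = {2 * k..<2 * k + k} \<union> {0..<k}"
    using mid[of "{2 * k..<2 * k + k}"] n k by (auto simp: image_Un)
  then have int: "{0..<3 * k} \<inter> (\<lambda>x. x mod n) ` {2 * k..<n + k} = {0..<k} \<union> {2 * k..<2 * k + k}"
    using n k by auto
  show ?thesis
  proof
    show "H 0 (2 * k - 1) \<subseteq> words {0..<3 * k}"
      using H_words[of 0 "2 * k - 1"] ivl by simp
    have Hw: "H (2 * k) (n - 1) \<subseteq> words {2 * k..<n + k}"
      using H_words[of "2 * k" "n - 1"] ivl n k by simp
    then show "relabel (\<lambda>x. x mod n) ` H (2 * k) (n - 1) \<subseteq> words ((\<lambda>x. x mod n) ` {2 * k..<n + k})"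
      by (auto intro: words_relabel)
    show "free_mod (H 0 (2 * k - 1)) ({0..<3 * k} \<inter> (\<lambda>x. x mod n) ` {2 * k..<n + k})"
      unfolding int using free_ends[of 0 "2 * k - 1"] k by simp
    \<comment> \<open>The second arc has \<open>n - 2 * k\<close> relators, at least the
      \<open>2 * k\<close> that \<open>free_ends\<close> requires; this is the source of the bound
      on n.\<close>
    have "free_mod (H (2 * k) (n - 1)) ({2 * k..<2 * k + k} \<union> {n..<n + k})"
      using free_ends[of "2 * k" "n - 1"] n k by simp
    then have "free_mod (relabel (\<lambda>x. x mod n) ` H (2 * k) (n - 1))
      ((\<lambda>x. x mod n) ` ({2 * k..<2 * k + k} \<union> {n..<n + k}))"
      using n k by (intro free_mod_relabel[OF inj Hw]) auto
    then show "free_mod (relabel (\<lambda>x. x mod n) ` H (2 * k) (n - 1))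
      ({0..<3 * k} \<inter> (\<lambda>x. x mod n) ` {2 * k..<n + k})"
      unfolding int im' by (simp add: Un_commute)
  qed
qed

lemma cong_C_0:
  assumes "u \<in> words {0..k}" "cong C u []"
  shows "cong {w} u []"
proof -
  have "u \<in> words {0..<3 * k}" using assms(1) k by (auto elim: words_mono)
  then have "cong (H 0 (2 * k - 1)) u []"
    using free_amalgam.embed_left[OF arcs, of u "[]"] assms(2) C_eq by simp
  then have "cong {r 0} u []"
    unfolding H_def using embed_piece[of 0 0 "2 * k - 1" u "[]"] assms(1) by simp
  then show ?thesis using relabel_id[OF w, of "\<lambda>j. j"] by (simp add: r_def)
qed

lemma cyc_C: "cyc n i ` C \<subseteq> C"
proof
  fix u assume "u \<in> cyc n i ` C"
  then obtain j where "u = cyc n i (cyc n j w)" by (auto simp: C_def)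
  then have "u = cyc n ((j + i) mod n) w"
    by (simp add: cyc_def relabel_relabel mod_simps add.assoc)
  moreover have "(j + i) mod n < n" using n k by simp
  ultimately show "u \<in> C" by (auto simp: C_def)
qed

text \<open>The relators are invariant under rotation, so rotating by \<open>n - i\<close> moves any
  block to the start, where it lies inside the first arc.\<close>

lemma cong_C:
  assumes i: "i < n" and u: "u \<in> words ((\<lambda>j. (i + j) mod n) ` {0..k})" "cong C u []"
  shows "cong {cyc n i w} u []"
proof -
  obtain v where v: "v \<in> words {0..k}" "u = relabel (\<lambda>j. (i + j) mod n) v"
    using u(1) by (rule words_relabelE)
  then have ui: "u = cyc n i v" by (simp add: cyc_def add.commute)
  have "cyc n (n - i) u = relabel (\<lambda>x. x) v"
    unfolding ui cyc_def relabel_relabel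
  proof (rule relabel_cong[OF v(1)])
    fix x assume "x \<in> {0..k}"
    then have "x < n" using n k by simp
    have "((x + i) mod n + (n - i)) mod n = (x + i + (n - i)) mod n" by (simp add: mod_simps)
    also have "x + i + (n - i) = x + n" using i by simp
    finally show "((x + i) mod n + (n - i)) mod n = x" using \<open>x < n\<close> by simp
  qed
  then have "cyc n (n - i) u = v" using relabel_id[OF v(1), of "\<lambda>x. x"] by simp
  then have "cong C v []"
    using cong_relabel[OF u(2), of "\<lambda>x. (x + (n - i)) mod n"] cyc_C[of "n - i"] cong_mono
    by (fastforce simp: cyc_def)
  then have "cong {w} v []" using cong_C_0 v(1) by blast
  then show ?thesis using cong_relabel[of "{w}" v "[]" "\<lambda>x. (x + i) mod n"] ui by (simp add: cyc_def)
qed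

lemma cyc_carrier:
  assumes "i < n"
  shows "cyc n i w \<in> carrier (free_group ((\<lambda>j. (i + j) mod n) ` {0..k}))"
proof -
  have "inj_on (\<lambda>x. (x + i) mod n) {0..k}"
  proof (rule inj_onI)
    fix x y assume "x \<in> {0..k}" "y \<in> {0..k}" "(x + i) mod n = (y + i) mod n"
    then show "x = y"
      using n k assms by (cases "x + i < n"; cases "y + i < n") (auto simp: le_mod_geq)
  qed
  moreover have "w \<in> carrier (free_group {0..k})"
    using w red by (simp add: words_carrier reduced_append)
  ultimately have "cyc n i w \<in> carrier (free_group ((\<lambda>x. (x + i) mod n) ` {0..k}))"
    unfolding cyc_def by (intro relabel_closed) (auto simp: bij_betw_def)
  then show ?thesis by (simp add: add.commute)
qed

lemma block_subset: "(\<lambda>j. (i + j) mod n) ` {0..k} \<subseteq> {0..<n}"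
  using n k by auto

lemma presentation_C: "presentation {0..<n} C"
proof
  show "C \<subseteq> carrier (free_group {0..<n})"
    using cyc_carrier block_subset by (fastforce simp: C_def words_carrier intro: words_mono)
qed

lemma piece_embeds:
  assumes "i < n"
  shows "\<exists>\<phi>\<in>mon (presented_group ((\<lambda>j. (i + j) mod n) ` {0..k}) {cyc n i w}) (presented_group {0..<n} C).
    \<forall>x\<in>(\<lambda>j. (i + j) mod n) ` {0..k}.
      \<phi> (presented_gen ((\<lambda>j. (i + j) mod n) ` {0..k}) {cyc n i w} x) = presented_gen {0..<n} C x"
proof (rule presentation_embedding)
  show "presentation ((\<lambda>j. (i + j) mod n) ` {0..k}) {cyc n i w}"
    using cyc_carrier[OF assms] by unfold_locales simp
qed (use presentation_C block_subset cong_C[OF assms] assms in \<open>auto simp: C_def\<close>)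

lemma infinite_C: "infinite (carrier (presented_group {0..<n} C))"
proof -
  interpret presentation "{0..<n}" C by (rule presentation_C)
  define x :: "nat \<Rightarrow> nat word" where "x m = replicate m (0, True)" for m
  have x: "x m \<in> words {0}" "reduced (x m)" for m
    by (induction m) (auto simp: x_def reduced_Cons letter_inv_def hd_replicate)
  have "inj (\<lambda>m. cls (x m))"
  proof (rule injI)
    fix m m' assume "cls (x m) = cls (x m')"
    moreover have "x m \<in> words {0..<n}" "x m' \<in> words {0..<n}"
      using n k by (auto intro: words_mono[OF x(1)])
    ultimately have "cong C (x m) (x m')" using cls_eq_iff by blast
    moreover have "x m \<in> words {0..k}" "x m' \<in> words {0..k}"
      by (auto intro: words_mono[OF x(1)])
    ultimately have "cong {w} (x m) (x m')"
      using cong_C_0[of "x m @ winv (x m')"] by (simp add: cong_iff_winv[of _ "x m"])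
    \<comment> \<open>Powers of the letter 0 omit the letter k, which differs from 0 because
      \<open>k \<ge> 1\<close>.\<close>
    moreover have "free_mod {w} {0}"
      using Freiheitssatz[OF red inv_k] k by (auto intro: free_mod_subset)
    ultimately have "cong {} (x m) (x m')" using free_mod_cong_iff x(1) by blast
    then have "length (x m) = length (x m')" using cong_empty_reduced x(2) by metis
    then show "m = m'" by (simp add: x_def)
  qed
  then have "infinite (range (\<lambda>m. cls (x m)))" using finite_imageD by blast
  moreover have "range (\<lambda>m. cls (x m)) \<subseteq> carrier (presented_group {0..<n} C)"
    using cls_closed by blast
  ultimately show ?thesis using infinite_super by blast
qed

end

end

lemma reduced_square:
  assumes "cyclically_reduced w" shows "reduced (w @ w)"
  using assms by (auto simp: cyclically_reduced_def reduced_append)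

theorem theorem1p1:
  fixes k n :: nat and w :: "nat word"
  defines "H1 \<equiv> presented_group {0..<3 * k} {relabel (\<lambda>j. j + i) w | i. i < 2 * k}"
    and "h \<equiv> presented_gen {0..<3 * k} {relabel (\<lambda>j. j + i) w | i. i < 2 * k}"
    and "G \<equiv> cyclically_presented_group n w"
    and "g \<equiv> presented_gen {0..<n} (cyclic_relators n w)"
  assumes "k \<ge> 1" and "n \<ge> 4 * k"
    and "w \<in> carrier (free_group {0..k})" and "cyclically_reduced w"
    and "involves w 0" and "involves w k"
    and "(\<Inter>j\<in>{0..k}. generate H1 (h ` {j..<j + k})) = {\<one>\<^bsub>H1\<^esub>}"
  shows "(\<forall>i<n. let X = (\<lambda>j. (i + j) mod n) ` {0..k}; R = {(theta n ^^ i) w} in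
            \<exists>\<phi>\<in>mon (presented_group X R) G. \<forall>x\<in>X. \<phi> (presented_gen X R x) = g x)
       \<and> infinite (carrier G)"
proof -
  interpret staggered k w
    using assms by unfold_locales (auto simp: words_carrier reduced_square)
  define R1 where "R1 = {relabel (\<lambda>j. j + i) w | i. i < 2 * k}"
  have "{..<2 * k} = {0..2 * k - 1}" using k by auto
  then have R1: "R1 = H 0 (2 * k - 1)"
    by (auto simp: R1_def H_def r_def)
  interpret P: presentation "{0..<3 * k}" R1
  proof
    have "reduced v" if "v \<in> R1" for v
      using that red reduced_relabel[of "\<lambda>j. j + _" w] by (auto simp: R1_def reduced_append)
    moreover have "R1 \<subseteq> words {0..<3 * k}"
      using H_words[of 0 "2 * k - 1"] k unfolding R1 by (simp add: atLeastLessThanSuc_atLeastAtMost[symmetric])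
    ultimately show "R1 \<subseteq> carrier (free_group {0..<3 * k})" by (auto simp: words_carrier)
  qed
  interpret trivial_intersection k w
  proof
    fix u assume u: "u \<in> words {0..<k}"
      and v: "\<And>j. j \<le> k \<Longrightarrow> \<exists>v\<in>words {j..<j + k}. cong (H 0 (2 * k - 1)) u v"
    \<comment> \<open>Representatives over all the blocks put the class of \<open>u\<close> into
      every subgroup of the intersection.\<close>
    have "P.cls u \<in> (\<Inter>j\<in>{0..k}. generate H1 (h ` {j..<j + k}))"
    proof
      fix j assume "j \<in> {0..k}"
      then obtain v where v: "v \<in> words {j..<j + k}" "cong R1 u v" and j: "j \<le> k"
        using v R1 by auto
      have "{j..<j + k} \<subseteq> {0..<3 * k}" using j by auto
      from P.cls_generate[OF this v(1)] show "P.cls u \<in> generate H1 (h ` {j..<j + k})"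
        using P.cls_cong[OF v(2)] by (simp add: H1_def h_def R1_def)
    qed
    then have "P.cls u \<in> {\<one>\<^bsub>H1\<^esub>}" unfolding assms(11) .
    then have "P.cls u = P.cls []"
      using P.cls_Nil by (simp add: H1_def R1_def)
    moreover have "u \<in> words {0..<3 * k}" using u by (auto elim: words_mono)
    ultimately show "cong (H 0 (2 * k - 1)) u []" using P.cls_eq_iff R1 by simp
  qed
  have "w \<in> words {0..<n}" using w assms(5,6) by (auto elim: words_mono)
  then have theta: "(theta n ^^ i) w = cyc n i w" for i by (rule theta_power)
  have "cyclic_relators n w = C n" by (simp add: cyclic_relators_def C_def theta assms(6))
  then have "G = presented_group {0..<n} (C n)" "g = presented_gen {0..<n} (C n)"
    by (simp_all add: G_def g_def cyclically_presented_group_def)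
  then show ?thesis
    using piece_embeds[OF assms(6)] infinite_C[OF assms(6)] by (simp add: Let_def theta)
qed

end
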